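(* There exists $c>0$ such that for every $\varepsilon \in (0,1)$ there exists $n_0\in\mathbb{N}$ such that every tournament $G$ on $n \ge n_0$ vertices with $\delta^0(G) \ge (1/2 - c)n$ contains a $D$-tiling covering all but at most $\varepsilon n$ vertices.
   Context: A tournament is a loopless directed graph with exactly one of $uv$, $vu$ for each pair of distinct vertices. $\delta^0(G)$ is the minimum of all in- and out-degrees of vertices of $G$. $D = D_{1,1,2}$ is the tournament on vertices $a,b,c_1,c_2$ with edges $ab, bc_1, bc_2, c_1a, c_2a, c_1c_2$. A $D$-tiling is a collection of vertex-disjoint copies of $D$ in $G$. *)

theory Defs
  imports Complex_Main "Graph_Theory.Graph_Theory"
begin

locale tournament = pair_digraph +
  assumes exactly_one_arc:
    "\<lbrakk>u \<in> pverts G; v \<in> pverts G; u \<noteq> v\<rbrakk> \<Longrightarrow> ((u, v) \<in> parcs G) \<noteq> ((v, u) \<in> parcs G)"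

text \<open>The minimum semidegree \<open>\<delta>\<^sup>0(G)\<close>; only meaningful for a finite nonempty vertex set.\<close>

definition min_semidegree :: "'a pair_pre_digraph \<Rightarrow> nat" where
  "min_semidegree G =
     Min (in_degree (with_proj G) ` pverts G \<union> out_degree (with_proj G) ` pverts G)"

datatype D112_vertex = Da | Db | Dc1 | Dc2

definition D112 :: "D112_vertex pair_pre_digraph" where
  "D112 = \<lparr>pverts = {Da, Db, Dc1, Dc2},
           parcs = {(Da, Db), (Db, Dc1), (Db, Dc2), (Dc1, Da), (Dc2, Da), (Dc1, Dc2)}\<rparr>"

text \<open>Copies are subgraphs, not necessarily induced. In a tournament, a copy of a
  tournament is automatically induced.\<close>

definition copy_of_in :: "'b pair_pre_digraph \<Rightarrow> 'a pair_pre_digraph \<Rightarrow> 'a pair_pre_digraph \<Rightarrow> bool" where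
  "copy_of_in H F G \<longleftrightarrow>
     subgraph (with_proj F) (with_proj G) \<and> digraph_iso (with_proj H) (with_proj F)"

definition is_tiling :: "'b pair_pre_digraph \<Rightarrow> 'a pair_pre_digraph set \<Rightarrow> 'a pair_pre_digraph \<Rightarrow> bool" where
  "is_tiling H T G \<longleftrightarrow>
     (\<forall>F\<in>T. copy_of_in H F G) \<and> pairwise (\<lambda>F F'. pverts F \<inter> pverts F' = {}) T"

end

theory Submission
  imports Defs "HOL-Library.Disjoint_Sets"
begin

text \<open>
  Two cyclic triangles sharing the edge \<open>ab\<close> form a copy of \<open>D\<close>. So a fractional tiling by cyclic
  triangles becomes a fractional \<open>D\<close>-tiling if the weight of the triangles at each edge is
  redistributed to pairs of triangles at that edge. In a regular tournament all vertices lie in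
  equally many cyclic triangles. In a nearly regular one the uniform weights are corrected to
  \<open>1 + y a + y b + y c\<close>, where \<open>y\<close> solves a linear system whose matrix is, up to small errors,
  \<open>(n\<^sup>2/8) I + (n J - K K\<^sup>T) / 4\<close> with \<open>K\<close> the skew \<open>\<plusminus>1\<close> matrix of the tournament. It is positive
  definite, since the largest eigenvalue of \<open>K K\<^sup>T\<close> is at most about \<open>n\<^sup>2 / \<surd>6 < n\<^sup>2 / 2\<close>.

  Near regularity survives the removal of a random copy of \<open>D\<close> drawn from this weighting, because
  each vertex is hit with the same probability and so all out-densities are martingales. Hence
  copies can be removed greedily, controlling the sum of the squared deviations of the
  out-densities, until only \<open>\<epsilon> n\<close> vertices remain.
\<close>

section \<open>Linear systems and triangle counts\<close>

text \<open>Gaussian elimination by induction on \<open>V\<close>: positivity at an indicator vector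
  makes the pivot \<open>B a a\<close> positive, and the Schur complement of the pivot is again
  positive definite.\<close>

lemma positive_definite_solvable:
  fixes B :: "'a \<Rightarrow> 'a \<Rightarrow> real"
  assumes "finite V"
    and "\<And>y. \<exists>v\<in>V. y v \<noteq> 0 \<Longrightarrow> (\<Sum>u\<in>V. \<Sum>v\<in>V. B u v * y u * y v) > 0"
  shows "\<exists>y. \<forall>u\<in>V. (\<Sum>v\<in>V. B u v * y v) = r u"
  using assms
proof (induction V arbitrary: B r rule: finite_induct)
  case empty
  then show ?case by simp
next
  case (insert a V)
  let ?b = "B a a"
  have upd: "(\<Sum>v\<in>V. f v * (y(a := t)) v) = (\<Sum>v\<in>V. f v * y v)" for f y and t :: real
    using insert.hyps by (intro sum.cong) auto
  have expand: "(\<Sum>u\<in>insert a V. \<Sum>v\<in>insert a V. B u v * y u * y v)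
      = ?b * y a * y a + y a * (\<Sum>v\<in>V. B a v * y v) + y a * (\<Sum>v\<in>V. B v a * y v)
        + (\<Sum>u\<in>V. \<Sum>v\<in>V. B u v * y u * y v)" for y
    using insert.hyps by (simp add: sum.distrib sum_distrib_left algebra_simps)
  have b: "?b > 0"
  proof -
    have "(\<Sum>u\<in>V. \<Sum>v\<in>V. B u v * (if u = a then 1 else 0) * (if v = a then 1 else 0)) = 0"
      "(\<Sum>v\<in>V. B a v * (if v = a then 1 else 0)) = 0"
      "(\<Sum>v\<in>V. B v a * (if v = a then 1 else 0)) = 0"
      using insert.hyps by (auto intro!: sum.neutral)
    then show ?thesis
      using insert.prems[of "\<lambda>v. if v = a then 1 else 0"] unfolding expand by simp
  qed
  define S where "S u v = B u v - B u a * B a v / ?b" for u v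
  have "\<exists>y. \<forall>u\<in>V. (\<Sum>v\<in>V. S u v * y v) = r u - B u a * r a / ?b"
  proof (rule insert.IH)
    fix y :: "'a \<Rightarrow> real" assume y: "\<exists>v\<in>V. y v \<noteq> 0"
    \<comment> \<open>This value solves row \<open>a\<close> with right side zero, so the form of
      \<open>B\<close> at the extended vector equals the form of the Schur complement
      \<open>S\<close> at \<open>y\<close>.\<close>
    define t where "t = - (\<Sum>v\<in>V. B a v * y v) / ?b"
    define y' where "y' = y(a := t)"
    have y': "\<And>v. v \<in> V \<Longrightarrow> y' v = y v" "y' a = t" using insert.hyps by (auto simp: y'_def)
    have "0 < (\<Sum>u\<in>insert a V. \<Sum>v\<in>insert a V. B u v * y' u * y' v)"
      using y y'(1) by (intro insert.prems) auto
    also have "\<dots> = ?b * t * t + t * (\<Sum>v\<in>V. B a v * y v) + t * (\<Sum>v\<in>V. B v a * y v)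
        + (\<Sum>u\<in>V. \<Sum>v\<in>V. B u v * y u * y v)"
      unfolding expand using y' by simp
    also have "?b * t * t + t * (\<Sum>v\<in>V. B a v * y v) = 0"
      using b by (simp add: t_def field_simps)
    also have "0 + t * (\<Sum>v\<in>V. B v a * y v) + (\<Sum>u\<in>V. \<Sum>v\<in>V. B u v * y u * y v)
        = (\<Sum>u\<in>V. \<Sum>v\<in>V. S u v * y u * y v)"
    proof -
      have "t * (\<Sum>v\<in>V. B v a * y v) = - (\<Sum>u\<in>V. \<Sum>v\<in>V. B u a * B a v / ?b * y u * y v)"
      proof -
        have "t * (\<Sum>v\<in>V. B v a * y v)
            = - ((\<Sum>v\<in>V. B v a * y v) * (\<Sum>v\<in>V. B a v * y v) / ?b)"
          by (simp add: t_def)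
        also have "\<dots> = - (\<Sum>u\<in>V. \<Sum>v\<in>V. B u a * B a v / ?b * y u * y v)"
          unfolding sum_product sum_divide_distrib by (simp add: mult_ac)
        finally show ?thesis .
      qed
      then show ?thesis
        by (simp add: S_def algebra_simps sum_subtractf sum_divide_distrib)
    qed
    finally show "0 < (\<Sum>u\<in>V. \<Sum>v\<in>V. S u v * y u * y v)" .
  qed
  then obtain y where y: "\<And>u. u \<in> V \<Longrightarrow> (\<Sum>v\<in>V. S u v * y v) = r u - B u a * r a / ?b"
    by blast
  define t where "t = (r a - (\<Sum>v\<in>V. B a v * y v)) / ?b"
  have "(\<Sum>v\<in>insert a V. B u v * (y(a := t)) v) = r u" if u: "u \<in> insert a V" for u
  proof -
    have eq: "(\<Sum>v\<in>insert a V. B u v * (y(a := t)) v) = B u a * t + (\<Sum>v\<in>V. B u v * y v)"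
      unfolding sum.insert[OF insert.hyps] upd by simp
    show ?thesis
    proof (cases "u = a")
      case True
      then show ?thesis unfolding eq using b by (simp add: t_def)
    next
      case False
      then have "u \<in> V" using u by simp
      have "(\<Sum>v\<in>V. S u v * y v) = (\<Sum>v\<in>V. B u v * y v) - B u a / ?b * (\<Sum>v\<in>V. B a v * y v)"
        by (simp add: S_def algebra_simps sum_subtractf sum_distrib_left sum_divide_distrib)
      then show ?thesis using y[OF \<open>u \<in> V\<close>] b unfolding eq unfolding t_def
        by (simp add: field_simps)
    qed
  qed
  then show ?case by blast
qed

section \<open>Cyclic triangle counts in terms of the skew sign matrix\<close>

locale finite_tournament =
  fixes V :: "'a set" and E :: "'a \<Rightarrow> 'a \<Rightarrow> bool"
  assumes finite_V: "finite V"
    and irrefl: "u \<in> V \<Longrightarrow> \<not> E u u"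
    and exactly_one: "u \<in> V \<Longrightarrow> v \<in> V \<Longrightarrow> u \<noteq> v \<Longrightarrow> E u v \<noteq> E v u"
begin

definition k :: "'a \<Rightarrow> 'a \<Rightarrow> real" where
  "k u v = of_bool (E u v) - of_bool (E v u)"

definition excess :: "'a \<Rightarrow> real" where
  "excess u = (\<Sum>v\<in>V. k u v)"

definition gram :: "'a \<Rightarrow> 'a \<Rightarrow> real" where
  "gram u v = (\<Sum>w\<in>V. k u w * k v w)"

definition tri :: "'a \<Rightarrow> 'a \<Rightarrow> 'a \<Rightarrow> real" where
  "tri a b c = of_bool (E a b \<and> E b c \<and> E c a)"

text \<open>Only the orientation that starts with the arc between \<open>u\<close> and
  \<open>v\<close> contributes, so no cyclic triangle through the pair is counted twice.\<close>

definition tri2 :: "'a \<Rightarrow> 'a \<Rightarrow> real" where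
  "tri2 u v = (\<Sum>w\<in>V. tri u v w + tri v u w)"

text \<open>Fixing \<open>v\<close> as the start of the cyclic order counts every cyclic triangle
  through \<open>v\<close> exactly once.\<close>

definition tri1 :: "'a \<Rightarrow> real" where
  "tri1 v = (\<Sum>b\<in>V. \<Sum>c\<in>V. tri v b c)"

lemma k_skew: "k v u = - k u v" by (simp add: k_def)
lemma k_self [simp]: "k u u = 0" by (simp add: k_def)
lemma k_square: "u \<in> V \<Longrightarrow> v \<in> V \<Longrightarrow> u \<noteq> v \<Longrightarrow> k u v = 1 \<or> k u v = -1"
  using exactly_one[of u v] by (auto simp: k_def)
lemma abs_k_le: "\<bar>k u v\<bar> \<le> 1" by (simp add: k_def)

lemma tri_cyclic: "tri a b c = tri b c a" "tri a b c = tri c a b" by (auto simp: tri_def)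
lemma tri_nonneg [simp]: "tri a b c \<ge> 0" by (simp add: tri_def)

text \<open>For distinct vertices the two indicators are products of three factors
  \<open>(1 + k) / 2\<close> and \<open>(1 - k) / 2\<close>, and the terms of odd degree cancel in
  the sum. If exactly two vertices coincide, the one surviving product is -1 and cancels the 1. If
  all three coincide nothing cancels, hence the last term.\<close>

lemma tri_eq_k:
  assumes "a \<in> V" "b \<in> V" "c \<in> V"
  shows "tri a b c + tri b a c
    = (1 + k a b * k b c + k b c * k c a + k c a * k a b) / 4 - of_bool (a = b \<and> b = c) / 4"
proof -
  have *: "E u v \<longleftrightarrow> \<not> E v u" if "u \<in> V" "v \<in> V" "u \<noteq> v" for u v
    using exactly_one[OF that] by blast
  consider "a = b \<or> b = c \<or> c = a" | "a \<noteq> b" "b \<noteq> c" "c \<noteq> a" by blast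
  then show ?thesis
  proof cases
    case 1
    have sq: "k u v * k v u = -1" if "u \<in> V" "v \<in> V" "u \<noteq> v" for u v
      using k_square[OF that] by (auto simp: k_skew[of v u])
    have "tri a b c = 0" "tri b a c = 0"
      using 1 assms irrefl by (auto simp: tri_def)
    moreover have "1 + k a b * k b c + k b c * k c a + k c a * k a b = of_bool (a = b \<and> b = c)"
    proof (cases "a = b \<and> b = c")
      case True
      then show ?thesis by simp
    next
      case False
      from 1 consider "a = b" "b \<noteq> c" | "b = c" "c \<noteq> a" | "c = a" "a \<noteq> b"
        using False by metis
      then show ?thesis
        using assms by cases (simp_all add: sq)
    qed
    ultimately show ?thesis by simp
  next
    case 2
    then have "E b a \<longleftrightarrow> \<not> E a b" "E c b \<longleftrightarrow> \<not> E b c" "E a c \<longleftrightarrow> \<not> E c a"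
      using assms * by metis+
    then show ?thesis using 2
      by (cases "E a b"; cases "E b c"; cases "E c a") (simp_all add: tri_def k_def)
  qed
qed

lemma gram_sym: "gram u v = gram v u"
  by (simp add: gram_def mult.commute)

text \<open>Sum of \<open>tri_eq_k\<close> over the third vertex. In a regular tournament the term
  with \<open>excess\<close> vanishes, and the matrix \<open>(n J - K K^T - I) / 4\<close>
  remains.\<close>

lemma tri2_eq:
  assumes "u \<in> V" "v \<in> V"
  shows "tri2 u v = (card V + k u v * (excess v - excess u) - gram u v) / 4 - of_bool (u = v) / 4"
proof -
  have "tri2 u v = (\<Sum>w\<in>V. (1 + k u v * k v w - k v w * k u w - k u v * k u w) / 4
      - of_bool (u = v \<and> v = w) / 4)"
    unfolding tri2_def
  proof (intro sum.cong refl)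
    fix w assume "w \<in> V"
    then show "tri u v w + tri v u w = (1 + k u v * k v w - k v w * k u w - k u v * k u w) / 4
        - of_bool (u = v \<and> v = w) / 4"
      using assms by (simp add: tri_eq_k k_skew[of w u] mult_ac)
  qed
  also have "\<dots> = (card V + k u v * excess v - gram u v - k u v * excess u) / 4 - of_bool (u = v) / 4"
  proof -
    have "(\<Sum>w\<in>V. of_bool (u = v \<and> v = w) / 4 :: real) = of_bool (u = v) / 4"
      using assms finite_V by (cases "u = v") (auto simp: sum_divide_distrib[symmetric])
    then show ?thesis
      by (simp add: sum_subtractf sum.distrib excess_def gram_def sum_distrib_left
          sum_divide_distrib[symmetric] mult.commute)
  qed
  finally show ?thesis by (simp add: algebra_simps)
qed

text \<open>A triangle through \<open>v\<close> contains two pairs at \<open>v\<close>.\<close>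

lemma tri1_eq_tri2: "2 * tri1 v = (\<Sum>u\<in>V. tri2 v u)"
proof -
  have "(\<Sum>u\<in>V. \<Sum>w\<in>V. tri u v w) = (\<Sum>u\<in>V. \<Sum>w\<in>V. tri v w u)"
    by (subst tri_cyclic(1)) (rule refl)
  also have "\<dots> = tri1 v" unfolding tri1_def by (rule sum.swap)
  finally show ?thesis by (simp add: tri2_def sum.distrib tri1_def)
qed

lemma sum_k_left: "(\<Sum>u\<in>V. k u w) = - excess w"
  unfolding excess_def sum_negf[symmetric] by (rule sum.cong) (simp_all add: k_skew[of w])

text \<open>Both corrections vanish in a regular tournament, leaving \<open>(n^2 - 1) / 8\<close>
  triangles at every vertex.\<close>

lemma tri1_eq:
  assumes "v \<in> V"
  shows "tri1 v = ((real (card V))\<^sup>2 - 1 + 2 * (\<Sum>w\<in>V. k v w * excess w) - (excess v)\<^sup>2) / 8"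
proof -
  have g: "(\<Sum>u\<in>V. gram v u) = - (\<Sum>w\<in>V. k v w * excess w)"
    unfolding gram_def
    by (subst sum.swap, subst sum_distrib_left[symmetric]) (simp add: sum_k_left sum_negf)
  have "2 * tri1 v = (\<Sum>u\<in>V. (card V + k v u * excess u - k v u * excess v - gram v u) / 4 - of_bool (v = u) / 4)"
    unfolding tri1_eq_tri2 using assms by (intro sum.cong) (auto simp: tri2_eq algebra_simps)
  also have "\<dots> = (real (card V) * card V + (\<Sum>u\<in>V. k v u * excess u) - excess v * excess v - (\<Sum>u\<in>V. gram v u)) / 4 - 1/4"
  proof -
    have "(\<Sum>u\<in>V. of_bool (v = u) / 4 :: real) = 1 / 4"
      using assms finite_V by (simp add: sum_divide_distrib[symmetric])
    then show ?thesis
      by (simp add: sum_subtractf sum.distrib sum_divide_distrib[symmetric] excess_def sum_distrib_right)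
  qed
  finally show ?thesis unfolding g by (simp add: power2_eq_square field_simps)
qed

end

section \<open>The spectral bound\<close>

context finite_tournament begin

text \<open>The Pfaffian of four distinct vertices is a sum of three signs, hence odd and nonzero. Summing
  its square over all quadruples bounds \<open>tr K\<^sup>4\<close>, which is \<open>gram_norm\<close>.\<close>

definition pfaff :: "'a \<Rightarrow> 'a \<Rightarrow> 'a \<Rightarrow> 'a \<Rightarrow> real" where
  "pfaff a b c d = k a b * k c d - k a c * k b d + k a d * k b c"

text \<open>The transpose of K applied to \<open>y\<close>; its squared norm is the quadratic form
  of \<open>gram\<close>.\<close>

definition transp_mult :: "('a \<Rightarrow> real) \<Rightarrow> 'a \<Rightarrow> real" where
  "transp_mult y w = (\<Sum>v\<in>V. k v w * y v)"

definition gram_norm :: real where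
  "gram_norm = (\<Sum>u\<in>V. \<Sum>v\<in>V. (gram u v)\<^sup>2)"

text \<open>A union bound stands in for the indicator of four distinct vertices: the right side is
  nonpositive as soon as two coincide, and its sum over all quadruples is immediate.\<close>

lemma pfaff_square_ge:
  assumes "a \<in> V" "b \<in> V" "c \<in> V" "d \<in> V"
  shows "(pfaff a b c d)\<^sup>2 \<ge> 1 - of_bool (a = b) - of_bool (a = c) - of_bool (a = d)
    - of_bool (b = c) - of_bool (b = d) - of_bool (c = d)"
proof (cases "a = b \<or> a = c \<or> a = d \<or> b = c \<or> b = d \<or> c = d")
  case True
  then have "1 - of_bool (a = b) - of_bool (a = c) - of_bool (a = d)
    - of_bool (b = c) - of_bool (b = d) - of_bool (c = d) \<le> (0::real)"
    by (auto simp: of_bool_def)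
  then show ?thesis using zero_le_power2[of "pfaff a b c d"] by linarith
next
  case False
  have s: "k a b = 1 \<or> k a b = -1" "k c d = 1 \<or> k c d = -1" "k a c = 1 \<or> k a c = -1"
    "k b d = 1 \<or> k b d = -1" "k a d = 1 \<or> k a d = -1" "k b c = 1 \<or> k b c = -1"
    using False assms by (simp_all add: k_square)
  have "k a b * k c d = 1 \<or> k a b * k c d = -1" "k a c * k b d = 1 \<or> k a c * k b d = -1"
    "k a d * k b c = 1 \<or> k a d * k b c = -1"
    using s by auto
  then have "pfaff a b c d \<in> {1, -1, 3, -3}" by (auto simp: pfaff_def)
  then show ?thesis using False by auto
qed

lemma sum_k_k_left: "(\<Sum>a\<in>V. k a b * k a c) = gram b c"
  unfolding gram_def by (intro sum.cong refl) (metis k_skew mult_minus_left mult_minus_right minus_minus)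

lemma gram_norm_le: "6 * gram_norm \<le> 2 * real (card V) ^ 4 + 6 * real (card V) ^ 3"
proof -
  let ?n = "real (card V)"
  define S4 :: "('a \<Rightarrow> 'a \<Rightarrow> 'a \<Rightarrow> 'a \<Rightarrow> real) \<Rightarrow> real"
    where "S4 f = (\<Sum>a\<in>V. \<Sum>b\<in>V. \<Sum>c\<in>V. \<Sum>d\<in>V. f a b c d)" for f
  have s12: "S4 f = S4 (\<lambda>b a c d. f a b c d)" for f
    unfolding S4_def by (rule sum.swap)
  have s23: "S4 f = S4 (\<lambda>a c b d. f a b c d)" for f
    unfolding S4_def by (intro sum.cong refl sum.swap)
  have s34: "S4 f = S4 (\<lambda>a b d c. f a b c d)" for f
    unfolding S4_def by (intro sum.cong refl sum.swap)
  have S4_mult: "S4 (\<lambda>a b c d. f a b c * g a b d) = (\<Sum>a\<in>V. \<Sum>b\<in>V. (\<Sum>c\<in>V. f a b c) * (\<Sum>d\<in>V. g a b d))" for f g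
    unfolding S4_def sum_product ..
  \<comment> \<open>The product of two of the three matchings is a closed walk around a 4-cycle.
    Summed over all quadruples it gives \<open>gram_norm\<close>, up to a sign determined by
    skewness.\<close>
  have 1: "S4 (\<lambda>a b c d. k a b * k c d * (k a c * k b d)) = gram_norm"
  proof -
    have "S4 (\<lambda>a b c d. k a b * k c d * (k a c * k b d)) = S4 (\<lambda>b c a d. k a b * k a c * (k c d * k b d))"
      by (subst s12, subst s23) (simp add: mult_ac)
    also have "\<dots> = gram_norm"
      unfolding S4_mult sum_k_k_left gram_def[symmetric] gram_norm_def
      by (simp add: power2_eq_square gram_sym)
    finally show ?thesis .
  qed
  have 2: "S4 (\<lambda>a b c d. k a b * k c d * (k a d * k b c)) = - gram_norm"
  proof -
    have eq: "k a b * k c d * (k a d * k b c) = k a b * k a d * (- k d c * k b c)" for a b c d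
      using k_skew[of c d] by simp
    have "S4 (\<lambda>a b c d. k a b * k c d * (k a d * k b c)) = S4 (\<lambda>b d a c. k a b * k a d * (- k d c * k b c))"
      by (subst s12, subst s34, subst s23) (simp only: eq)
    also have "\<dots> = - gram_norm"
      unfolding S4_mult sum_k_k_left mult_minus_left sum_negf gram_def[symmetric] gram_norm_def
      by (simp add: power2_eq_square gram_sym sum_negf)
    finally show ?thesis .
  qed
  have 3: "S4 (\<lambda>a b c d. k a c * k b d * (k a d * k b c)) = gram_norm"
  proof -
    have "S4 (\<lambda>a b c d. k a c * k b d * (k a d * k b c)) = S4 (\<lambda>c d a b. k a c * k a d * (k b d * k b c))"
      by (subst s23, subst s12, subst s34, subst s23) (simp add: mult_ac)
    also have "\<dots> = gram_norm"
      unfolding S4_mult sum_k_k_left gram_norm_def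
      by (simp add: power2_eq_square gram_sym)
    finally show ?thesis .
  qed
  have sq: "(k u v)\<^sup>2 \<le> 1" for u v
    using abs_k_le[of u v] by (simp add: abs_square_le_1)
  have le: "S4 f \<le> S4 g" if "\<And>a b c d. a \<in> V \<Longrightarrow> b \<in> V \<Longrightarrow> c \<in> V \<Longrightarrow> d \<in> V \<Longrightarrow> f a b c d \<le> g a b c d" for f g
    unfolding S4_def using that by (intro sum_mono) auto
  have add: "S4 (\<lambda>a b c d. f a b c d + g a b c d) = S4 f + S4 g" for f g
    by (simp add: S4_def sum.distrib)
  have diff: "S4 (\<lambda>a b c d. f a b c d - g a b c d) = S4 f - S4 g" for f g
    by (simp add: S4_def sum_subtractf)
  have scale: "S4 (\<lambda>a b c d. t * f a b c d) = t * S4 f" for f t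
    by (simp add: S4_def sum_distrib_left)
  have "S4 (\<lambda>a b c d. 1 - of_bool (a = b) - of_bool (a = c) - of_bool (a = d)
    - of_bool (b = c) - of_bool (b = d) - of_bool (c = d)) \<le> S4 (\<lambda>a b c d. (pfaff a b c d)\<^sup>2)"
    by (intro le pfaff_square_ge)
  \<comment> \<open>The three squares in the expansion are at most 1 each. The mixed terms have
    coefficients -2, 2, -2 and sums \<open>gram_norm\<close>, \<open>- gram_norm\<close>,
    \<open>gram_norm\<close>, so all three push the same way and give
    \<open>- 6 * gram_norm\<close>.\<close>
  also have "\<dots> \<le> S4 (\<lambda>a b c d. 3 - 2 * (k a b * k c d * (k a c * k b d))
      + 2 * (k a b * k c d * (k a d * k b c)) - 2 * (k a c * k b d * (k a d * k b c)))"
  proof (rule le)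
    fix a b c d
    have "(k u v * k u' v')\<^sup>2 \<le> 1" for u v u' v'
      using sq[of u v] sq[of u' v'] by (simp add: power_mult_distrib mult_le_one)
    from this[of a b c d] this[of a c b d] this[of a d b c]
    show "(pfaff a b c d)\<^sup>2 \<le> 3 - 2 * (k a b * k c d * (k a c * k b d))
      + 2 * (k a b * k c d * (k a d * k b c)) - 2 * (k a c * k b d * (k a d * k b c))"
      unfolding pfaff_def power2_eq_square by (simp add: algebra_simps)
  qed
  also have "\<dots> = 3 * ?n ^ 4 - 6 * gram_norm"
    unfolding add diff scale 1 2 3 by (simp add: S4_def eval_nat_numeral)
  also have "S4 (\<lambda>a b c d. 1 - of_bool (a = b) - of_bool (a = c) - of_bool (a = d)
    - of_bool (b = c) - of_bool (b = d) - of_bool (c = d)) = ?n ^ 4 - 6 * ?n ^ 3"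
  proof -
    have delta: "(\<Sum>b\<in>V. t * of_bool (x = b)) = t" if "x \<in> V" for x and t :: real
      using that finite_V by (simp add: sum_distrib_left[symmetric])
    have const: "S4 (\<lambda>a b c d. 1) = ?n ^ 4" by (simp add: S4_def power4_eq_xxxx)
    have "S4 (\<lambda>a b c d. of_bool (c = d)) = ?n ^ 3"
      using delta[of _ 1] by (simp add: S4_def power3_eq_cube)
    moreover have "S4 (\<lambda>a b c d. of_bool (b = c)) = ?n ^ 3"
      "S4 (\<lambda>a b c d. of_bool (b = d)) = ?n ^ 3"
      "S4 (\<lambda>a b c d. of_bool (a = d)) = ?n ^ 3"
      "S4 (\<lambda>a b c d. of_bool (a = c)) = ?n ^ 3"
      "S4 (\<lambda>a b c d. of_bool (a = b)) = ?n ^ 3"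
      using delta[of _ 1] delta[of _ ?n] delta[of _ "?n * ?n"]
      by (simp_all add: S4_def power3_eq_cube mult_ac)
    ultimately show ?thesis unfolding diff const by simp
  qed
  finally show ?thesis by simp
qed

lemma gram_quadratic: "(\<Sum>u\<in>V. \<Sum>v\<in>V. gram u v * y u * y v) = (\<Sum>w\<in>V. (transp_mult y w)\<^sup>2)"
proof -
  have "(\<Sum>u\<in>V. \<Sum>v\<in>V. gram u v * y u * y v) = (\<Sum>u\<in>V. \<Sum>v\<in>V. \<Sum>w\<in>V. (k u w * y u) * (k v w * y v))"
    by (simp add: gram_def sum_distrib_left mult_ac)
  also have "\<dots> = (\<Sum>u\<in>V. \<Sum>w\<in>V. \<Sum>v\<in>V. (k u w * y u) * (k v w * y v))"
    by (intro sum.cong refl sum.swap)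
  also have "\<dots> = (\<Sum>w\<in>V. \<Sum>u\<in>V. \<Sum>v\<in>V. (k u w * y u) * (k v w * y v))"
    by (rule sum.swap)
  finally show ?thesis by (simp add: transp_mult_def power2_eq_square sum_product)
qed

lemma sum_mult_transp_mult: "(\<Sum>w\<in>V. x w * transp_mult y w) = - (\<Sum>w\<in>V. y w * transp_mult x w)"
proof -
  have "(\<Sum>w\<in>V. x w * transp_mult y w) = (\<Sum>w\<in>V. \<Sum>v\<in>V. - (y v * (k w v * x w)))"
    unfolding transp_mult_def sum_distrib_left
    by (intro sum.cong refl) (metis k_skew mult.commute mult.left_commute mult_minus_left)
  also have "\<dots> = - (\<Sum>w\<in>V. y w * transp_mult x w)"
    unfolding transp_mult_def sum_distrib_left sum_negf by (subst sum.swap) (rule refl)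
  finally show ?thesis .
qed

text \<open>The nonzero eigenvalues of the Gram matrix of a skew matrix come in pairs, which is what
  makes the Frobenius norm bound strong enough: \<open>y\<close> and its image are orthogonal.\<close>

lemma transp_mult_norm_le:
  assumes Y: "(\<Sum>v\<in>V. (y v)\<^sup>2) > 0"
  shows "2 * (\<Sum>w\<in>V. (transp_mult y w)\<^sup>2)\<^sup>2 \<le> gram_norm * (\<Sum>v\<in>V. (y v)\<^sup>2)\<^sup>2"
proof -
  define Y where "Y = (\<Sum>v\<in>V. (y v)\<^sup>2)"
  define h where "h = transp_mult y"
  define H where "H = (\<Sum>w\<in>V. (h w)\<^sup>2)"
  define Q where "Q = (\<Sum>w\<in>V. (transp_mult h w)\<^sup>2)"
  have Ypos: "Y > 0" using Y by (simp add: Y_def)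
  have yh: "(\<Sum>w\<in>V. y w * h w) = 0"
    using sum_mult_transp_mult[of y y] by (simp add: h_def)
  have yg: "(\<Sum>w\<in>V. y w * transp_mult h w) = - H"
    using sum_mult_transp_mult[of y h] by (simp add: h_def H_def power2_eq_square)
  \<comment> \<open>Cauchy-Schwarz for \<open>y\<close> and \<open>transp_mult h\<close>, whose
    inner product is \<open>- H\<close>.\<close>
  have "0 \<le> (\<Sum>w\<in>V. (Y * transp_mult h w + H * y w)\<^sup>2)" by (intro sum_nonneg) auto
  also have "\<dots> = Y\<^sup>2 * Q + 2 * Y * H * (\<Sum>w\<in>V. y w * transp_mult h w) + H\<^sup>2 * Y"
    unfolding Q_def sum_distrib_left
    by (simp add: power2_eq_square algebra_simps sum.distrib sum_distrib_left Y_def[unfolded power2_eq_square])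
  also have "\<dots> = Y * (Y * Q - H\<^sup>2)"
    unfolding yg by (simp add: power2_eq_square algebra_simps)
  finally have QH: "H\<^sup>2 \<le> Y * Q" using Ypos by (simp add: zero_le_mult_iff)
  \<comment> \<open>Two orthogonal rank-one matrices are subtracted from the Gram matrix.
    \<open>\<alpha>\<close> is the projection coefficient onto y y^T. \<open>\<beta>\<close> is the
    one onto h h^T when \<open>y\<close> is an eigenvector; in general it avoids dividing by
    \<open>H\<close>, and all terms in \<open>H\<close> cancel.\<close>
  define \<alpha> \<beta> where "\<alpha> = H / Y\<^sup>2" and "\<beta> = 1 / Y"
  have hh: "(\<Sum>u\<in>V. \<Sum>v\<in>V. f u * g u * (f v * g v)) = (\<Sum>u\<in>V. f u * g u)\<^sup>2" for f g :: "'a \<Rightarrow> real"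
    by (simp add: power2_eq_square sum_product)
  have "0 \<le> (\<Sum>u\<in>V. \<Sum>v\<in>V. (gram u v - \<alpha> * (y u * y v) - \<beta> * (h u * h v))\<^sup>2)"
    by (intro sum_nonneg) auto
  also have "\<dots> = (\<Sum>u\<in>V. \<Sum>v\<in>V. (gram u v)\<^sup>2 - 2 * \<alpha> * (gram u v * y u * y v) - 2 * \<beta> * (gram u v * h u * h v)
      + \<alpha>\<^sup>2 * (y u * y u * (y v * y v)) + \<beta>\<^sup>2 * (h u * h u * (h v * h v))
      + 2 * \<alpha> * \<beta> * (y u * h u * (y v * h v)))"
    by (intro sum.cong refl) (simp add: power2_eq_square algebra_simps)
  also have "\<dots> = gram_norm - 2 * \<alpha> * H - 2 * \<beta> * Q + \<alpha>\<^sup>2 * Y\<^sup>2 + \<beta>\<^sup>2 * H\<^sup>2"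
    unfolding sum.distrib sum_subtractf sum_distrib_left[symmetric] gram_quadratic hh yh
    by (simp add: gram_norm_def H_def h_def Q_def Y_def power2_eq_square sum_distrib_right[symmetric])
  also have "\<dots> = gram_norm - 2 * Q / Y"
    using Ypos by (simp add: \<alpha>_def \<beta>_def field_simps power2_eq_square)
  finally have "2 * Q \<le> gram_norm * Y" using Ypos by (simp add: field_simps)
  then have "2 * Q * Y \<le> gram_norm * Y\<^sup>2" using Ypos
    by (simp add: power2_eq_square)
  with QH show ?thesis by (simp add: H_def h_def Y_def mult_ac)
qed

text \<open>\<open>gram_norm\<close> is about n^4 / 3, so the factor is about 1 / sqrt 6 = 0.408;
  the value 41/100 absorbs the cubic term once n is at least 1000.\<close>

lemma transp_mult_norm_le_card:
  assumes "card V \<ge> 1000"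
  shows "(\<Sum>w\<in>V. (transp_mult y w)\<^sup>2) \<le> 41/100 * (real (card V))\<^sup>2 * (\<Sum>v\<in>V. (y v)\<^sup>2)"
proof (cases "(\<Sum>v\<in>V. (y v)\<^sup>2) > 0")
  case False
  then have "(\<Sum>v\<in>V. (y v)\<^sup>2) = 0" using sum_nonneg[of V "\<lambda>v. (y v)\<^sup>2"] by simp
  then have "\<And>v. v \<in> V \<Longrightarrow> y v = 0" using finite_V by (simp add: sum_nonneg_eq_0_iff)
  then show ?thesis by (simp add: transp_mult_def)
next
  case True
  define n where "n = real (card V)"
  define Y where "Y = (\<Sum>v\<in>V. (y v)\<^sup>2)"
  define H where "H = (\<Sum>w\<in>V. (transp_mult y w)\<^sup>2)"
  have n: "n \<ge> 1000" using assms by (simp add: n_def)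
  have "1000 * n ^ 3 \<le> n * n ^ 3" using n by (intro mult_right_mono) auto
  then have "1000 * n ^ 3 \<le> n ^ 4" by (simp add: eval_nat_numeral)
  moreover have "6 * gram_norm \<le> 2 * n ^ 4 + 6 * n ^ 3"
    using gram_norm_le by (simp add: n_def)
  ultimately have "gram_norm \<le> 3362/10000 * n ^ 4"
    using zero_le_power[of n 4] n by linarith
  then have G: "gram_norm \<le> 2 * (41/100)\<^sup>2 * n ^ 4"
    by (simp add: power2_eq_square)
  have "2 * H\<^sup>2 \<le> gram_norm * Y\<^sup>2" using transp_mult_norm_le[OF True] by (simp add: H_def Y_def)
  also have "\<dots> \<le> 2 * (41/100)\<^sup>2 * n ^ 4 * Y\<^sup>2" using G by (intro mult_right_mono) auto
  also have "\<dots> = 2 * (41/100 * n\<^sup>2 * Y)\<^sup>2"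
    by (simp add: power2_eq_square power4_eq_xxxx)
  finally have "H\<^sup>2 \<le> (41/100 * n\<^sup>2 * Y)\<^sup>2" by simp
  then have "H \<le> 41/100 * n\<^sup>2 * Y"
    by (rule power2_le_imp_le) (use True in \<open>simp add: Y_def\<close>)
  then show ?thesis by (simp add: H_def Y_def n_def)
qed

end

section \<open>Balanced triangle weights\<close>

context finite_tournament begin

text \<open>The Gram matrix of the incidence matrix between vertices and cyclic triangles:
  \<open>tri2\<close> vanishes on the diagonal, where the count is \<open>tri1\<close>.\<close>

definition gram_tri :: "'a \<Rightarrow> 'a \<Rightarrow> real" where
  "gram_tri u v = tri2 u v + (if u = v then tri1 u else 0)"

lemma tri2_le:
  assumes "u \<in> V" "v \<in> V"
  shows "tri2 u v \<le> card V"
proof -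
  have "tri2 u v \<le> (\<Sum>w\<in>V. 1)"
    unfolding tri2_def
  proof (rule sum_mono)
    fix w
    show "tri u v w + tri v u w \<le> 1"
      using assms irrefl exactly_one[of u v] by (cases "u = v") (auto simp: tri_def)
  qed
  then show ?thesis by simp
qed

lemma tri2_nonneg: "tri2 u v \<ge> 0"
  unfolding tri2_def by (intro sum_nonneg) simp

lemma gram_tri_mult:
  assumes "v \<in> V"
  shows "(\<Sum>u\<in>V. gram_tri v u * y u) = tri1 v * y v + (\<Sum>u\<in>V. tri2 v u * y u)"
proof -
  have "(\<Sum>u\<in>V. (if v = u then tri1 v else 0) * y u) = (\<Sum>u\<in>V. if v = u then tri1 v * y u else 0)"
    by (intro sum.cong) auto
  then show ?thesis
    using assms finite_V by (simp add: gram_tri_def distrib_right sum.distrib)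
qed

text \<open>This is where the linear system comes from: making all vertex marginals of the corrected
  weights equal to n^2 / 8 means solving for \<open>y\<close> with matrix \<open>gram_tri\<close>
  and right side n^2 / 8 - \<open>tri1\<close>.\<close>

lemma tri_marginal:
  assumes "v \<in> V"
  shows "(\<Sum>b\<in>V. \<Sum>c\<in>V. tri v b c * (1 + y v + y b + y c)) = tri1 v + (\<Sum>u\<in>V. gram_tri v u * y u)"
proof -
  have "(\<Sum>b\<in>V. \<Sum>c\<in>V. tri v b c * y c) = (\<Sum>c\<in>V. \<Sum>b\<in>V. tri c v b * y c)"
    by (subst sum.swap) (intro sum.cong refl arg_cong2[where f = "(*)"] tri_cyclic(2))
  then have "(\<Sum>b\<in>V. \<Sum>c\<in>V. tri v b c * y b) + (\<Sum>b\<in>V. \<Sum>c\<in>V. tri v b c * y c) = (\<Sum>u\<in>V. tri2 v u * y u)"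
    by (simp add: tri2_def sum_distrib_right sum.distrib distrib_right)
  moreover have "(\<Sum>b\<in>V. \<Sum>c\<in>V. tri v b c * (1 + y v + y b + y c))
    = tri1 v + tri1 v * y v + ((\<Sum>b\<in>V. \<Sum>c\<in>V. tri v b c * y b) + (\<Sum>b\<in>V. \<Sum>c\<in>V. tri v b c * y c))"
    by (simp add: distrib_left sum.distrib tri1_def sum_distrib_right)
  ultimately show ?thesis by (simp add: gram_tri_mult[OF assms])
qed

lemma sum_abs_square_le: "(\<Sum>v\<in>V. \<bar>y v\<bar>)\<^sup>2 \<le> real (card V) * (\<Sum>v\<in>V. (y v)\<^sup>2)" for y :: "'a \<Rightarrow> real"
proof -
  have "(\<Sum>v\<in>V. \<bar>y v\<bar>)\<^sup>2 = (\<Sum>u\<in>V. \<Sum>v\<in>V. \<bar>y u\<bar> * \<bar>y v\<bar>)"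
    by (simp add: power2_eq_square sum_product)
  also have "\<dots> \<le> (\<Sum>u\<in>V. \<Sum>v\<in>V. ((y u)\<^sup>2 + (y v)\<^sup>2) / 2)"
  proof (intro sum_mono)
    fix u v
    show "\<bar>y u\<bar> * \<bar>y v\<bar> \<le> ((y u)\<^sup>2 + (y v)\<^sup>2) / 2"
      using sum_squares_bound[of "\<bar>y u\<bar>" "\<bar>y v\<bar>"] by simp
  qed
  also have "\<dots> = real (card V) * (\<Sum>v\<in>V. (y v)\<^sup>2)"
    by (simp add: sum.distrib sum_divide_distrib[symmetric] sum_distrib_left[symmetric])
  finally show ?thesis .
qed

end

locale near_regular_tournament = finite_tournament +
  assumes card_V: "card V \<ge> 100000"
    and excess_le: "v \<in> V \<Longrightarrow> \<bar>excess v\<bar> \<le> real (card V) / 50000"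
begin

definition n :: real where "n = real (card V)"

lemma n_ge: "n \<ge> 100000" using card_V by (simp add: n_def)

lemma n_square_ge: "n\<^sup>2 \<ge> 10000000000"
  using power_mono[OF n_ge, of 2] by simp

text \<open>In \<open>tri1_eq\<close> the sum with \<open>excess\<close> contributes at most n^2 /
  200000; the square and the constant are far smaller.\<close>

lemma tri1_approx:
  assumes "v \<in> V"
  shows "\<bar>n\<^sup>2 / 8 - tri1 v\<bar> \<le> n\<^sup>2 / 100000"
proof -
  have "\<bar>\<Sum>w\<in>V. k v w * excess w\<bar> \<le> (\<Sum>w\<in>V. n / 50000)"
  proof (rule order_trans[OF sum_abs sum_mono])
    fix w assume "w \<in> V"
    then have "\<bar>k v w\<bar> * \<bar>excess w\<bar> \<le> 1 * (n / 50000)"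
      using abs_k_le excess_le by (intro mult_mono) (auto simp: n_def)
    then show "\<bar>k v w * excess w\<bar> \<le> n / 50000" by (simp add: abs_mult)
  qed
  then have 1: "\<bar>\<Sum>w\<in>V. k v w * excess w\<bar> \<le> n\<^sup>2 / 50000"
    by (simp add: n_def[symmetric] power2_eq_square)
  have "\<bar>excess v\<bar>\<^sup>2 \<le> (n / 50000)\<^sup>2"
    using excess_le[OF assms] by (intro power_mono) (auto simp: n_def)
  then have 2: "(excess v)\<^sup>2 \<le> n\<^sup>2 / 2500000000" by (simp add: power_divide)
  define S e where "S = (\<Sum>w\<in>V. k v w * excess w)" and "e = (excess v)\<^sup>2"
  have t: "tri1 v = (n\<^sup>2 - 1 + 2 * S - e) / 8"
    by (simp add: tri1_eq[OF assms] n_def S_def e_def)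
  have "S \<le> n\<^sup>2 / 50000" "- S \<le> n\<^sup>2 / 50000" "e \<ge> 0" "e \<le> n\<^sup>2 / 2500000000"
    using 1 2 by (simp_all add: S_def e_def abs_le_iff)
  then show ?thesis
    unfolding t using n_square_ge by (intro abs_leI) (simp_all add: field_simps)
qed

text \<open>The diagonal contributes nearly n^2 / 8 and the Gram part takes away at most (41/400)
  n^2, leaving about 0.0225 n^2 per unit of squared norm. The all-ones part is nonnegative, and the
  errors from \<open>excess\<close> fit into the gap above 1/50.\<close>

lemma gram_tri_coercive:
  "(\<Sum>u\<in>V. \<Sum>v\<in>V. gram_tri u v * y u * y v) \<ge> n\<^sup>2 / 50 * (\<Sum>v\<in>V. (y v)\<^sup>2)"
proof -
  define Y where "Y = (\<Sum>v\<in>V. (y v)\<^sup>2)"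
  define H where "H = (\<Sum>w\<in>V. (transp_mult y w)\<^sup>2)"
  define s where "s u v = k u v * (excess v - excess u)" for u v
  have Y: "Y \<ge> 0" by (simp add: Y_def sum_nonneg)
  have "(\<Sum>u\<in>V. \<Sum>v\<in>V. gram_tri u v * y u * y v) = (\<Sum>u\<in>V. y u * (\<Sum>v\<in>V. gram_tri u v * y v))"
    by (simp add: sum_distrib_left mult_ac)
  also have "\<dots> = (\<Sum>u\<in>V. y u * (tri1 u * y u + (\<Sum>v\<in>V. tri2 u v * y v)))"
    by (intro sum.cong refl) (simp only: gram_tri_mult)
  also have "\<dots> = (\<Sum>u\<in>V. tri1 u * (y u)\<^sup>2) + (\<Sum>u\<in>V. \<Sum>v\<in>V. tri2 u v * (y u * y v))"
    by (simp add: distrib_left sum.distrib sum_distrib_left power2_eq_square mult_ac)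
  also have "(\<Sum>u\<in>V. \<Sum>v\<in>V. tri2 u v * (y u * y v))
    = (\<Sum>u\<in>V. \<Sum>v\<in>V. n / 4 * (y u * y v) + 1/4 * (s u v * (y u * y v)) - 1/4 * (gram u v * y u * y v)
        - 1/4 * (of_bool (u = v) * (y u * y v)))"
    by (intro sum.cong refl) (simp add: tri2_eq s_def n_def field_simps)
  also have "\<dots> = n / 4 * (\<Sum>u\<in>V. \<Sum>v\<in>V. y u * y v) + 1/4 * (\<Sum>u\<in>V. \<Sum>v\<in>V. s u v * (y u * y v)) - 1/4 * H
    - 1/4 * (\<Sum>u\<in>V. \<Sum>v\<in>V. of_bool (u = v) * (y u * y v))"
    unfolding sum.distrib sum_subtractf sum_distrib_left[symmetric] gram_quadratic H_def ..
  also have "(\<Sum>u\<in>V. \<Sum>v\<in>V. of_bool (u = v) * (y u * y v)) = Y"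
  proof -
    have "(\<Sum>v\<in>V. of_bool (u = v) * (y u * y v)) = (y u)\<^sup>2" if "u \<in> V" for u
    proof -
      have "(\<Sum>v\<in>V. of_bool (u = v) * (y u * y v)) = (\<Sum>v\<in>V. if u = v then (y u)\<^sup>2 else 0)"
        by (intro sum.cong) (auto simp: power2_eq_square)
      then show ?thesis using that finite_V by simp
    qed
    then show ?thesis unfolding Y_def by (rule sum.cong[OF refl])
  qed
  also have "(\<Sum>u\<in>V. \<Sum>v\<in>V. y u * y v) = (\<Sum>v\<in>V. y v)\<^sup>2"
    by (simp add: power2_eq_square sum_product)
  finally have eq: "(\<Sum>u\<in>V. \<Sum>v\<in>V. gram_tri u v * y u * y v) = (\<Sum>u\<in>V. tri1 u * (y u)\<^sup>2)
    + (n / 4 * (\<Sum>v\<in>V. y v)\<^sup>2 + 1/4 * (\<Sum>u\<in>V. \<Sum>v\<in>V. s u v * (y u * y v)) - 1/4 * H - 1/4 * Y)" .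
  have 1: "(\<Sum>u\<in>V. tri1 u * (y u)\<^sup>2) \<ge> (1/8 - 1/100000) * n\<^sup>2 * Y"
    unfolding Y_def sum_distrib_left
  proof (rule sum_mono)
    fix v assume "v \<in> V"
    then have "(1/8 - 1/100000) * n\<^sup>2 \<le> tri1 v" using tri1_approx[of v] unfolding abs_le_iff by (simp add: algebra_simps)
    then show "(1/8 - 1/100000) * n\<^sup>2 * (y v)\<^sup>2 \<le> tri1 v * (y v)\<^sup>2" by (rule mult_right_mono) simp
  qed
  have 2: "(\<Sum>u\<in>V. \<Sum>v\<in>V. s u v * (y u * y v)) \<ge> - (n\<^sup>2 / 25000 * Y)"
  proof -
    have "- (s u v * (y u * y v)) \<le> n / 25000 * (\<bar>y u\<bar> * \<bar>y v\<bar>)" if "u \<in> V" "v \<in> V" for u v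
    proof -
      have "\<bar>excess v - excess u\<bar> \<le> n / 25000"
        using excess_le[OF that(1)] excess_le[OF that(2)] abs_triangle_ineq4[of "excess v" "excess u"]
        by (simp add: n_def)
      then have "\<bar>s u v\<bar> \<le> 1 * (n / 25000)"
        unfolding s_def abs_mult by (intro mult_mono abs_k_le) auto
      then have "\<bar>s u v * (y u * y v)\<bar> \<le> n / 25000 * (\<bar>y u\<bar> * \<bar>y v\<bar>)"
        unfolding abs_mult[of "s u v"] abs_mult[of "y u"] by (intro mult_right_mono) auto
      then show ?thesis by linarith
    qed
    then have "- (\<Sum>u\<in>V. \<Sum>v\<in>V. s u v * (y u * y v)) \<le> (\<Sum>u\<in>V. \<Sum>v\<in>V. n / 25000 * (\<bar>y u\<bar> * \<bar>y v\<bar>))"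
      unfolding sum_negf[symmetric] by (intro sum_mono)
    also have "\<dots> = n / 25000 * (\<Sum>v\<in>V. \<bar>y v\<bar>)\<^sup>2"
      by (simp add: power2_eq_square sum_product sum_distrib_left mult_ac)
    also have "\<dots> \<le> n / 25000 * (n * Y)"
      using sum_abs_square_le[of y] n_ge by (intro mult_left_mono) (auto simp: n_def Y_def)
    finally show ?thesis by (simp add: power2_eq_square algebra_simps)
  qed
  have 3: "H \<le> 41/100 * n\<^sup>2 * Y"
    using transp_mult_norm_le_card[of y] card_V by (simp add: H_def Y_def n_def)
  have 4: "10000000000 * Y \<le> n\<^sup>2 * Y" using n_square_ge Y by (intro mult_right_mono)
  have 5: "n / 4 * (\<Sum>v\<in>V. y v)\<^sup>2 \<ge> 0" using n_ge by simp
  have "n\<^sup>2 * Y \<ge> 0" using Y by simp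
  then show ?thesis unfolding eq Y_def[symmetric] using 1 2 3 4 5 by (simp add: algebra_simps)
qed

text \<open>Existence follows from coercivity. The bound on \<open>y\<close> is obtained in two
  rounds: first for its l1 norm, then pointwise from the individual rows of the system.\<close>

lemma balanced_triangle_potential:
  obtains y where "\<And>v. v \<in> V \<Longrightarrow> \<bar>y v\<bar> \<le> 1/100"
    and "\<And>v. v \<in> V \<Longrightarrow> (\<Sum>b\<in>V. \<Sum>c\<in>V. tri v b c * (1 + y v + y b + y c)) = n\<^sup>2 / 8"
proof -
  have "\<exists>y. \<forall>u\<in>V. (\<Sum>v\<in>V. gram_tri u v * y v) = n\<^sup>2 / 8 - tri1 u"
  proof (rule positive_definite_solvable[OF finite_V])
    fix y :: "'a \<Rightarrow> real" assume "\<exists>v\<in>V. y v \<noteq> 0"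
    then obtain v where "v \<in> V" "y v \<noteq> 0" by blast
    then have "(\<Sum>v\<in>V. (y v)\<^sup>2) > 0" by (intro sum_pos2[of _ v]) (use finite_V in auto)
    then have "n\<^sup>2 / 50 * (\<Sum>v\<in>V. (y v)\<^sup>2) > 0" using n_ge by simp
    then show "(\<Sum>u\<in>V. \<Sum>v\<in>V. gram_tri u v * y u * y v) > 0"
      using gram_tri_coercive[of y] by linarith
  qed
  then obtain y where y: "\<And>u. u \<in> V \<Longrightarrow> (\<Sum>v\<in>V. gram_tri u v * y v) = n\<^sup>2 / 8 - tri1 u" by blast
  define S where "S = (\<Sum>v\<in>V. \<bar>y v\<bar>)"
  define Y where "Y = (\<Sum>v\<in>V. (y v)\<^sup>2)"
  have S0: "S \<ge> 0" by (simp add: S_def sum_nonneg)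
  \<comment> \<open>Pairing the system with \<open>y\<close> compares coercivity with the small
    right side. Together with Cauchy-Schwarz this bounds the l1 norm \<open>S\<close> by n /
    2000.\<close>
  have "n\<^sup>2 / 50 * Y \<le> (\<Sum>u\<in>V. \<Sum>v\<in>V. gram_tri u v * y u * y v)"
    unfolding Y_def by (rule gram_tri_coercive)
  also have "\<dots> = (\<Sum>u\<in>V. y u * (\<Sum>v\<in>V. gram_tri u v * y v))"
    by (simp add: sum_distrib_left mult_ac)
  also have "\<dots> = (\<Sum>u\<in>V. y u * (n\<^sup>2 / 8 - tri1 u))"
    by (intro sum.cong refl) (simp only: y)
  also have "\<dots> \<le> (\<Sum>u\<in>V. \<bar>y u\<bar> * (n\<^sup>2 / 100000))"
  proof (rule sum_mono)
    fix u assume "u \<in> V"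
    have "y u * (n\<^sup>2 / 8 - tri1 u) \<le> \<bar>y u\<bar> * \<bar>n\<^sup>2 / 8 - tri1 u\<bar>"
      using abs_ge_self[of "y u * (n\<^sup>2 / 8 - tri1 u)"] by (simp add: abs_mult)
    also have "\<dots> \<le> \<bar>y u\<bar> * (n\<^sup>2 / 100000)"
      using tri1_approx[OF \<open>u \<in> V\<close>] by (intro mult_left_mono) auto
    finally show "y u * (n\<^sup>2 / 8 - tri1 u) \<le> \<bar>y u\<bar> * (n\<^sup>2 / 100000)" .
  qed
  also have "\<dots> = n\<^sup>2 / 50 * (S / 2000)"
    unfolding sum_distrib_right[symmetric] S_def by simp
  finally have "Y \<le> S / 2000" using n_ge by (simp add: mult_le_cancel_left_pos)
  have "S\<^sup>2 \<le> n * Y" using sum_abs_square_le[of y] by (simp add: S_def n_def Y_def)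
  also have "\<dots> \<le> n * (S / 2000)" using \<open>Y \<le> S / 2000\<close> n_ge by (intro mult_left_mono) auto
  finally have "S * S \<le> S * (n / 2000)" by (simp add: power2_eq_square mult_ac)
  then have S: "S \<le> n / 2000"
    using S0 n_ge by (cases "S = 0") (auto simp: mult_le_cancel_left)
  show ?thesis
  proof
    fix v assume v: "v \<in> V"
    show "(\<Sum>b\<in>V. \<Sum>c\<in>V. tri v b c * (1 + y v + y b + y c)) = n\<^sup>2 / 8"
      by (simp add: tri_marginal[OF v] y[OF v])
    \<comment> \<open>Row \<open>v\<close> of the system: the \<open>tri2\<close> part is at most n
      * \<open>S\<close>, while the coefficient \<open>tri1 v\<close> of \<open>y v\<close> has
      order n^2, so \<open>y v\<close> itself is small.\<close>
    have "\<bar>\<Sum>u\<in>V. tri2 v u * y u\<bar> \<le> (\<Sum>u\<in>V. n * \<bar>y u\<bar>)"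
    proof (rule order_trans[OF sum_abs sum_mono])
      fix u assume "u \<in> V"
      then show "\<bar>tri2 v u * y u\<bar> \<le> n * \<bar>y u\<bar>"
        using tri2_le[OF v, of u] tri2_nonneg[of v u] by (auto simp: abs_mult n_def intro: mult_right_mono)
    qed
    also have "\<dots> = n * S" by (simp add: S_def sum_distrib_left)
    also have "\<dots> \<le> n * (n / 2000)" using S n_ge by (intro mult_left_mono) auto
    finally have 1: "\<bar>\<Sum>u\<in>V. tri2 v u * y u\<bar> \<le> n\<^sup>2 / 2000" by (simp add: power2_eq_square)
    have "tri1 v * y v = n\<^sup>2 / 8 - tri1 v - (\<Sum>u\<in>V. tri2 v u * y u)"
      using y[OF v] gram_tri_mult[OF v, of y] by simp
    then have "\<bar>tri1 v * y v\<bar> \<le> n\<^sup>2 * (12/100 * (1/100))"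
      using 1 tri1_approx[OF v] zero_le_power2[of n] by linarith
    moreover have t: "tri1 v \<ge> 12/100 * n\<^sup>2"
      using tri1_approx[OF v] zero_le_power2[of n] by linarith
    then have "12/100 * n\<^sup>2 * \<bar>y v\<bar> \<le> \<bar>tri1 v * y v\<bar>"
      unfolding abs_mult by (intro mult_right_mono) auto
    ultimately have "(12/100 * n\<^sup>2) * \<bar>y v\<bar> \<le> (12/100 * n\<^sup>2) * (1/100)" by linarith
    then show "\<bar>y v\<bar> \<le> 1/100" using n_ge by (subst (asm) mult_le_cancel_left_pos) auto
  qed
qed

end

section \<open>Balanced weights on copies of D\<close>

text \<open>The direction between \<open>c\<close> and \<open>d\<close> is left open: in a
  tournament one of the two arcs is present, and swapping the roles of \<open>c\<close> and
  \<open>d\<close> if necessary gives a copy of D.\<close>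

definition D_tuple :: "('a \<Rightarrow> 'a \<Rightarrow> bool) \<Rightarrow> 'a \<Rightarrow> 'a \<Rightarrow> 'a \<Rightarrow> 'a \<Rightarrow> bool" where
  "D_tuple E a b c d \<longleftrightarrow> E a b \<and> E b c \<and> E b d \<and> E c a \<and> E d a \<and> c \<noteq> d"

text \<open>The symmetric matrix with zero diagonal and row sums \<open>x\<close> of the form \<open>x c + x d - const\<close>.\<close>

definition pair_weight :: "'b set \<Rightarrow> ('b \<Rightarrow> real) \<Rightarrow> 'b \<Rightarrow> 'b \<Rightarrow> real" where
  "pair_weight C x c d = (if c \<in> C \<and> d \<in> C \<and> c \<noteq> d
     then (x c + x d - sum x C / (real (card C) - 1)) / (real (card C) - 2) else 0)"

lemma pair_weight_sym: "pair_weight C x c d = pair_weight C x d c"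
  by (auto simp: pair_weight_def add.commute)

lemma pair_weight_sum:
  assumes "finite V" "C \<subseteq> V" "card C \<ge> 3"
  shows "(\<Sum>d\<in>V. pair_weight C x c d) = (if c \<in> C then x c else 0)"
proof (cases "c \<in> C")
  case True
  define m where "m = real (card C)"
  have m: "m \<ge> 3" using assms(3) by (simp add: m_def)
  have fin: "finite C" using assms finite_subset by blast
  have "(\<Sum>d\<in>V. pair_weight C x c d) = (\<Sum>d\<in>C - {c}. (x c + x d - sum x C / (m - 1)) / (m - 2))"
    using assms True by (intro sum.mono_neutral_cong_right) (auto simp: pair_weight_def m_def)
  also have "\<dots> = ((m - 1) * x c + (sum x C - x c) - sum x C) / (m - 2)"
    using True fin m by (simp add: sum_divide_distrib[symmetric] sum_subtractf sum.distrib sum_diff1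
      card_Diff_singleton m_def)
  also have "\<dots> = x c" using m by (simp add: field_simps)
  finally show ?thesis using True by simp
next
  case False
  then show ?thesis by (simp add: pair_weight_def)
qed

lemma pair_weight_nonneg:
  assumes "\<And>c. c \<in> C \<Longrightarrow> 97/100 \<le> x c \<and> x c \<le> 103/100" "card C \<ge> 3"
  shows "pair_weight C x c d \<ge> 0"
proof (cases "c \<in> C \<and> d \<in> C \<and> c \<noteq> d")
  case True
  define m where "m = real (card C)"
  have m: "m \<ge> 3" using assms(2) by (simp add: m_def)
  have "sum x C \<le> m * (103/100)"
    unfolding m_def using assms(1) by (intro sum_bounded_above) auto
  \<comment> \<open>Here \<open>m / (m - 1)\<close> is at most 3/2, as \<open>m\<close> is at least
    3, whereas \<open>x c + x d\<close> is at least 2 * 97/100.\<close>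
  then have "sum x C / (m - 1) \<le> 194/100"
    using m by (simp add: field_simps)
  then have "x c + x d - sum x C / (m - 1) \<ge> 0"
    using True assms(1)[of c] assms(1)[of d] by linarith
  then show ?thesis using m by (simp add: pair_weight_def m_def)
next
  case False
  then show ?thesis by (auto simp: pair_weight_def)
qed

context near_regular_tournament begin

text \<open>Every triangle is used once at each of its three edges. At the edge \<open>ab\<close> it contributes its weight
  to \<open>c\<close> and half of it to each of \<open>a\<close> and \<open>b\<close>, so the balance of the triangles carries over. Edges in
  fewer than three triangles are skipped, which costs only \<open>O(1 / n)\<close>.\<close>

lemma balanced_D_weights:
  obtains W :: "'a \<Rightarrow> 'a \<Rightarrow> 'a \<Rightarrow> 'a \<Rightarrow> real"
  where "\<And>a b c d. W a b c d \<ge> 0"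
    and "\<And>a b c d. W a b c d > 0 \<Longrightarrow> D_tuple E a b c d"
    and "\<And>v. v \<in> V \<Longrightarrow> (\<Sum>b\<in>V. \<Sum>c\<in>V. \<Sum>d\<in>V. W v b c d) \<le> 1 / n"
    and "\<And>v. v \<in> V \<Longrightarrow> (\<Sum>a\<in>V. \<Sum>c\<in>V. \<Sum>d\<in>V. W a v c d) \<le> 1 / n"
    and "\<And>v. v \<in> V \<Longrightarrow> (\<Sum>a\<in>V. \<Sum>b\<in>V. \<Sum>d\<in>V. W a b v d) \<le> 1 / n"
    and "\<And>v. v \<in> V \<Longrightarrow> (\<Sum>a\<in>V. \<Sum>b\<in>V. \<Sum>c\<in>V. W a b c v) \<le> 1 / n"
    and "(\<Sum>a\<in>V. \<Sum>b\<in>V. \<Sum>c\<in>V. \<Sum>d\<in>V. W a b c d) \<ge> 1 - 20 / n"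
proof -
  obtain y where y: "\<And>v. v \<in> V \<Longrightarrow> \<bar>y v\<bar> \<le> 1/100"
    and bal: "\<And>v. v \<in> V \<Longrightarrow> (\<Sum>b\<in>V. \<Sum>c\<in>V. tri v b c * (1 + y v + y b + y c)) = n\<^sup>2 / 8"
    using balanced_triangle_potential by blast
  define C where "C a b = {c \<in> V. a \<in> V \<and> b \<in> V \<and> E a b \<and> E b c \<and> E c a}" for a b
  define x where "x a b c = 1 + y a + y b + y c" for a b c
  \<comment> \<open>The factor 8 / n^3 turns the balanced marginal n^2 / 8 into 1 / n, so the total
    over ordered triples is 1.\<close>
  define t where "t a b c = tri a b c * x a b c * (8 / n ^ 3)" for a b c
  define g where "g a b c = of_bool (card (C a b) \<ge> 3) * t a b c" for a b c
  \<comment> \<open>On a fixed arc \<open>ab\<close> the weights \<open>t a b c\<close> become the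
    row sums of a symmetric weight on pairs of triangles, so \<open>c\<close> and \<open>d\<close>
    have the same marginals.\<close>
  define W where "W a b c d = of_bool (card (C a b) \<ge> 3) * pair_weight (C a b) (x a b) c d * (8 / n ^ 3)" for a b c d
  have C: "C a b \<subseteq> V" "finite (C a b)" for a b
    using finite_V by (auto simp: C_def)
  have x: "97/100 \<le> x a b c \<and> x a b c \<le> 103/100" if "a \<in> V" "b \<in> V" "c \<in> V" for a b c
    using y[OF that(1)] y[OF that(2)] y[OF that(3)] unfolding x_def by linarith
  have x': "97/100 \<le> x a b c \<and> x a b c \<le> 103/100" if "c \<in> C a b" for a b c
    using x that by (auto simp: C_def)
  have t0: "t a b c \<ge> 0" if "a \<in> V" "b \<in> V" "c \<in> V" for a b c
    using x[OF that] n_ge by (auto simp: t_def)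
  have g_le: "g a b c \<le> t a b c" if "a \<in> V" "b \<in> V" "c \<in> V" for a b c
    using t0[OF that] by (simp add: g_def)
  have t_marg: "(\<Sum>b\<in>V. \<Sum>c\<in>V. t v b c) = 1 / n" if "v \<in> V" for v
  proof -
    have "(\<Sum>b\<in>V. \<Sum>c\<in>V. t v b c) = n\<^sup>2 / 8 * (8 / n ^ 3)"
      unfolding t_def x_def sum_distrib_right[symmetric] bal[OF that] ..
    also have "\<dots> = 1 / n" using n_ge by (simp add: field_simps eval_nat_numeral)
    finally show ?thesis .
  qed
  have t_cyc: "t a b c = t b c a" for a b c
    by (simp add: t_def x_def tri_cyclic(1)[of a b c])
  have W_sym: "W a b c d = W a b d c" for a b c d
    by (simp add: W_def pair_weight_sym)
  have W_sum: "(\<Sum>d\<in>V. W a b c d) = g a b c" if "a \<in> V" "b \<in> V" "c \<in> V" for a b c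
  proof (cases "card (C a b) \<ge> 3")
    case True
    have "(\<Sum>d\<in>V. W a b c d) = (\<Sum>d\<in>V. pair_weight (C a b) (x a b) c d) * (8 / n ^ 3)"
      unfolding W_def sum_distrib_right using True by simp
    also have "\<dots> = g a b c"
      unfolding pair_weight_sum[OF finite_V C(1) True] using True that
      by (simp add: g_def t_def C_def tri_def)
    finally show ?thesis .
  qed (simp add: W_def g_def)
  have W_sum': "(\<Sum>c\<in>V. W a b c d) = g a b d" if "a \<in> V" "b \<in> V" "d \<in> V" for a b d
    using W_sum[OF that] by (simp add: W_sym[of a b _ d])
  show ?thesis
  proof
    show "W a b c d \<ge> 0" for a b c d
    proof (cases "card (C a b) \<ge> 3")
      case True
      then have "pair_weight (C a b) (x a b) c d \<ge> 0" using x' by (intro pair_weight_nonneg) auto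
      then show ?thesis using n_ge by (simp add: W_def)
    qed (simp add: W_def)
    show "D_tuple E a b c d" if "W a b c d > 0" for a b c d
      using that by (auto simp: W_def pair_weight_def C_def D_tuple_def split: if_splits)
    fix v assume v: "v \<in> V"
    have "(\<Sum>b\<in>V. \<Sum>c\<in>V. \<Sum>d\<in>V. W v b c d) = (\<Sum>b\<in>V. \<Sum>c\<in>V. g v b c)"
      by (intro sum.cong refl W_sum v)
    also have "\<dots> \<le> (\<Sum>b\<in>V. \<Sum>c\<in>V. t v b c)"
      by (intro sum_mono g_le v)
    finally show "(\<Sum>b\<in>V. \<Sum>c\<in>V. \<Sum>d\<in>V. W v b c d) \<le> 1 / n" by (simp add: t_marg[OF v])
    have "(\<Sum>a\<in>V. \<Sum>c\<in>V. \<Sum>d\<in>V. W a v c d) = (\<Sum>a\<in>V. \<Sum>c\<in>V. g a v c)"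
      by (intro sum.cong refl W_sum v)
    also have "\<dots> \<le> (\<Sum>a\<in>V. \<Sum>c\<in>V. t a v c)"
      by (intro sum_mono g_le v)
    also have "\<dots> = (\<Sum>a\<in>V. \<Sum>c\<in>V. t v c a)"
      by (intro sum.cong refl t_cyc)
    also have "\<dots> = 1 / n" by (subst sum.swap) (rule t_marg[OF v])
    finally show "(\<Sum>a\<in>V. \<Sum>c\<in>V. \<Sum>d\<in>V. W a v c d) \<le> 1 / n" .
    have g3: "(\<Sum>a\<in>V. \<Sum>b\<in>V. g a b v) \<le> 1 / n"
    proof -
      have "(\<Sum>a\<in>V. \<Sum>b\<in>V. g a b v) \<le> (\<Sum>a\<in>V. \<Sum>b\<in>V. t a b v)"
        by (intro sum_mono g_le v)
      also have "\<dots> = (\<Sum>a\<in>V. \<Sum>b\<in>V. t v a b)"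
        by (intro sum.cong refl t_cyc[symmetric])
      finally show ?thesis by (simp add: t_marg[OF v])
    qed
    have "(\<Sum>a\<in>V. \<Sum>b\<in>V. \<Sum>d\<in>V. W a b v d) = (\<Sum>a\<in>V. \<Sum>b\<in>V. g a b v)"
      by (intro sum.cong refl W_sum v)
    then show "(\<Sum>a\<in>V. \<Sum>b\<in>V. \<Sum>d\<in>V. W a b v d) \<le> 1 / n" using g3 by simp
    have "(\<Sum>a\<in>V. \<Sum>b\<in>V. \<Sum>c\<in>V. W a b c v) = (\<Sum>a\<in>V. \<Sum>b\<in>V. g a b v)"
      by (intro sum.cong refl W_sum' v)
    then show "(\<Sum>a\<in>V. \<Sum>b\<in>V. \<Sum>c\<in>V. W a b c v) \<le> 1 / n" using g3 by simp
  next
    \<comment> \<open>A skipped arc lies in at most two triangles, each of weight at most (103/100)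
      * 8 / n^3; there are at most n^2 such arcs.\<close>
    have lose: "(\<Sum>c\<in>V. t a b c - g a b c) \<le> 20 / n ^ 3" if ab: "a \<in> V" "b \<in> V" for a b
    proof (cases "card (C a b) \<ge> 3")
      case True
      then show ?thesis using n_ge by (simp add: g_def)
    next
      case False
      then have "(\<Sum>c\<in>V. t a b c - g a b c) = (\<Sum>c\<in>V. t a b c)" by (simp add: g_def)
      also have "\<dots> = (\<Sum>c\<in>C a b. x a b c * (8 / n ^ 3))"
        using finite_V ab C by (intro sum.mono_neutral_cong_right) (auto simp: t_def tri_def C_def)
      also have "\<dots> \<le> real (card (C a b)) * (103/100 * (8 / n ^ 3))"
        using x' n_ge by (intro sum_bounded_above mult_right_mono) auto
      also have "\<dots> \<le> 2 * (103/100 * (8 / n ^ 3))"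
        using False n_ge by (intro mult_right_mono) auto
      also have "\<dots> \<le> 20 / n ^ 3" using n_ge by (simp add: field_simps)
      finally show ?thesis .
    qed
    have "(\<Sum>a\<in>V. \<Sum>b\<in>V. \<Sum>c\<in>V. t a b c - g a b c) \<le> (\<Sum>a\<in>V. \<Sum>b\<in>V. 20 / n ^ 3)"
      by (intro sum_mono lose)
    also have "\<dots> = 20 / n"
      using n_ge by (simp add: n_def[symmetric] field_simps eval_nat_numeral)
    finally have "(\<Sum>a\<in>V. \<Sum>b\<in>V. \<Sum>c\<in>V. t a b c) - (\<Sum>a\<in>V. \<Sum>b\<in>V. \<Sum>c\<in>V. g a b c) \<le> 20 / n"
      by (simp add: sum_subtractf)
    moreover have "(\<Sum>a\<in>V. \<Sum>b\<in>V. \<Sum>c\<in>V. t a b c) = 1"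
      using n_ge by (simp add: t_marg n_def)
    moreover have "(\<Sum>a\<in>V. \<Sum>b\<in>V. \<Sum>c\<in>V. \<Sum>d\<in>V. W a b c d) = (\<Sum>a\<in>V. \<Sum>b\<in>V. \<Sum>c\<in>V. g a b c)"
      by (intro sum.cong refl W_sum)
    ultimately show "(\<Sum>a\<in>V. \<Sum>b\<in>V. \<Sum>c\<in>V. \<Sum>d\<in>V. W a b c d) \<ge> 1 - 20 / n" by linarith
  qed
qed

end

section \<open>Removing random copies\<close>

text \<open>First-moment argument for weights whose total need not be 1, which is why the error is
  divided by the total.\<close>

lemma weighted_average_exists:
  fixes w f :: "'i \<Rightarrow> real"
  assumes "finite I" "\<And>i. i \<in> I \<Longrightarrow> w i \<ge> 0" "sum w I > 0"
    and "(\<Sum>i\<in>I. w i * f i) \<le> sum w I * F + e"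
  shows "\<exists>i\<in>I. w i > 0 \<and> f i \<le> F + e / sum w I"
proof (rule ccontr)
  assume "\<not> ?thesis"
  then have f: "f i > F + e / sum w I" if "i \<in> I" "w i > 0" for i
    using that by force
  obtain j where j: "j \<in> I" "w j > 0"
    using assms(2,3) sum_nonpos[of I w] by force
  have "0 < (\<Sum>i\<in>I. w i * (f i - (F + e / sum w I)))"
  proof (rule sum_pos2[OF assms(1) j(1)])
    show "0 < w j * (f j - (F + e / sum w I))" using f[OF j] j by simp
    show "0 \<le> w i * (f i - (F + e / sum w I))" if "i \<in> I" for i
      using f[OF that] assms(2)[OF that] by (cases "w i = 0") auto
  qed
  also have "\<dots> = (\<Sum>i\<in>I. w i * f i) - sum w I * (F + e / sum w I)"
    by (simp only: right_diff_distrib sum_subtractf sum_distrib_right)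
  also have "\<dots> = (\<Sum>i\<in>I. w i * f i) - sum w I * F - e"
    using assms(3) by (simp add: distrib_left)
  finally show False using assms(4) by linarith
qed

definition outdeg :: "('a \<Rightarrow> 'a \<Rightarrow> bool) \<Rightarrow> 'a set \<Rightarrow> 'a \<Rightarrow> real" where
  "outdeg E R v = real (card {u \<in> R. E v u})"

text \<open>The sum runs over all of \<open>V\<close>, including vertices already removed, and
  compares with the original densities. This makes it one potential for the whole removal
  process.\<close>

definition deviation :: "('a \<Rightarrow> 'a \<Rightarrow> bool) \<Rightarrow> 'a set \<Rightarrow> 'a set \<Rightarrow> real" where
  "deviation E V R = (\<Sum>v\<in>V. (outdeg E R v / card R - outdeg E V v / real (card V))\<^sup>2)"

lemma deviation_nonneg: "deviation E V R \<ge> 0"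
  by (simp add: deviation_def sum_nonneg)

lemma outdeg_le: "finite R \<Longrightarrow> outdeg E R v \<le> card R"
  by (simp add: outdeg_def card_mono)

lemma outdeg_ratio:
  assumes "finite R"
  shows "outdeg E R v / card R \<ge> 0" "outdeg E R v / card R \<le> 1"
proof -
  show "outdeg E R v / card R \<ge> 0" by (simp add: outdeg_def)
  show "outdeg E R v / card R \<le> 1"
    using outdeg_le[OF assms, of E v] by (cases "card R = 0") (simp_all add: divide_le_eq)
qed

lemma card_split: "finite A \<Longrightarrow> card {u \<in> A. P u} + card {u \<in> A. \<not> P u} = card A"
  using card_Un_disjoint[of "{u \<in> A. P u}" "{u \<in> A. \<not> P u}"]
  by (simp add: disjoint_iff Collect_disj_eq[symmetric] conj_disj_distribL[symmetric])

lemma sum_weight_card_Int: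
  fixes w :: "'i \<Rightarrow> real"
  assumes "finite X" "finite I" "\<And>i. i \<in> I \<Longrightarrow> w i \<noteq> 0 \<Longrightarrow> S i \<subseteq> X"
  shows "(\<Sum>i\<in>I. w i * card {u \<in> S i. P u}) = (\<Sum>u\<in>{u \<in> X. P u}. \<Sum>i\<in>I. w i * of_bool (u \<in> S i))"
proof -
  have "w i * card {u \<in> S i. P u} = (\<Sum>u\<in>{u \<in> X. P u}. w i * of_bool (u \<in> S i))" if "i \<in> I" for i
  proof (cases "w i = 0")
    case False
    then have "{u \<in> X. P u} \<inter> S i = {u \<in> S i. P u}" using assms(3)[OF that] by auto
    then show ?thesis using assms(1)
      by (simp add: sum_distrib_left[symmetric] of_bool_def sum.inter_restrict[symmetric])
  qed simp
  then have "(\<Sum>i\<in>I. w i * card {u \<in> S i. P u}) = (\<Sum>i\<in>I. \<Sum>u\<in>{u \<in> X. P u}. w i * of_bool (u \<in> S i))"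
    by (rule sum.cong[OF refl])
  also have "\<dots> = (\<Sum>u\<in>{u \<in> X. P u}. \<Sum>i\<in>I. w i * of_bool (u \<in> S i))" by (rule sum.swap)
  finally show ?thesis .
qed

text \<open>A random 4-set that meets every vertex with (nearly) the same probability leaves the
  out-density of each vertex (nearly) unchanged in expectation, and changes it by \<open>O(1 / card R)\<close>,
  so the sum of squared deviations increases by little.\<close>

lemma exists_small_deviation_step:
  fixes w :: "'i \<Rightarrow> real"
  assumes fin: "finite V" "finite I" and sub: "R \<subseteq> V" "R' \<subseteq> R"
    and w0: "\<And>i. i \<in> I \<Longrightarrow> w i \<ge> 0"
    and S: "\<And>i. i \<in> I \<Longrightarrow> w i > 0 \<Longrightarrow> S i \<subseteq> R' \<and> card (S i) = 4"
    and marg: "\<And>u. u \<in> R' \<Longrightarrow> (\<Sum>i\<in>I. w i * of_bool (u \<in> S i)) \<le> 4 / real (card R')"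
    and m: "1/2 \<le> sum w I" "sum w I \<le> 1"
    and \<rho>: "real (card R) / real (card R') - sum w I \<le> \<rho>"
    and R: "card R > 4" "card R' > 0"
  shows "\<exists>i\<in>I. w i > 0 \<and> deviation E V (R - S i) \<le> deviation E V R
    + 2 * (real (card V) * (8 * \<rho> / (real (card R) - 4) + 16 / (real (card R) - 4)\<^sup>2))"
proof -
  define m where "m = sum w I"
  define r where "r = real (card R)"
  define r' where "r' = real (card R')"
  define \<phi> where "\<phi> v = outdeg E R v / r" for v
  define \<psi> where "\<psi> v = outdeg E V v / real (card V)" for v
  define N where "N v i = real (card {u \<in> S i. E v u})" for v i
  \<comment> \<open>The change in the out-density of \<open>v\<close> when the four vertices of
    \<open>S i\<close> leave \<open>R\<close>.\<close>
  define \<delta> where "\<delta> v i = (4 * \<phi> v - N v i) / (r - 4)" for v i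
  define e where "e = 8 * \<rho> / (r - 4) + 16 / (r - 4)\<^sup>2"
  have finR: "finite R" "finite R'"
    using finite_subset[OF sub(1) fin(1)] finite_subset[OF sub(2)] by simp_all
  have r: "r > 4" "r' > 0" "r \<ge> r'"
    using R sub finR by (auto simp: r_def r'_def intro: card_mono)
  have \<phi>: "0 \<le> \<phi> v" "\<phi> v \<le> 1" for v
    unfolding \<phi>_def r_def using outdeg_ratio[OF finR(1)] by auto
  have \<psi>: "0 \<le> \<psi> v" "\<psi> v \<le> 1" for v
    unfolding \<psi>_def using outdeg_ratio[OF fin(1)] by auto
  have N: "0 \<le> N v i \<and> N v i \<le> 4" if "i \<in> I" "w i > 0" for v i
  proof -
    have "finite (S i)" using S[OF that] finR finite_subset by blast
    then have "card {u \<in> S i. E v u} \<le> card (S i)" by (intro card_mono) auto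
    then show ?thesis using S[OF that] by (simp add: N_def)
  qed
  have new: "outdeg E (R - S i) v / card (R - S i) = \<phi> v + \<delta> v i" if i: "i \<in> I" "w i > 0" for v i
  proof -
    have Si: "S i \<subseteq> R" "card (S i) = 4" "finite (S i)" using S[OF i] sub finR finite_subset by blast+
    then have c: "real (card (R - S i)) = r - 4"
      using finR R by (simp add: card_Diff_subset r_def of_nat_diff)
    have "{u \<in> R - S i. E v u} = {u \<in> R. E v u} - {u \<in> S i. E v u}" by auto
    then have "card {u \<in> R - S i. E v u} = card {u \<in> R. E v u} - card {u \<in> S i. E v u}"
      using Si by (simp only:) (intro card_Diff_subset, auto)
    moreover have "card {u \<in> S i. E v u} \<le> card {u \<in> R. E v u}"
      using Si finR by (intro card_mono) auto
    ultimately have "outdeg E (R - S i) v = \<phi> v * r - N v i"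
      using r by (simp add: outdeg_def N_def \<phi>_def)
    then show ?thesis
      unfolding c \<delta>_def using r by (simp add: field_simps)
  qed
  have drift: "\<bar>\<Sum>i\<in>I. w i * \<delta> v i\<bar> \<le> 4 * \<rho> / (r - 4)" for v
  proof -
    define p where "p u = (\<Sum>i\<in>I. w i * of_bool (u \<in> S i))" for u
    have S': "S i \<subseteq> R'" if "i \<in> I" "w i \<noteq> 0" for i using S[OF that(1)] w0[OF that(1)] that(2) by simp
    have p_le: "p u \<le> 4 / r'" if "u \<in> R'" for u using marg[OF that] by (simp add: p_def r'_def)
    have NS: "(\<Sum>i\<in>I. w i * N v i) = (\<Sum>u\<in>{u \<in> R'. E v u}. p u)"
      unfolding N_def p_def by (rule sum_weight_card_Int[OF finR(2) fin(2) S'])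
    \<comment> \<open>The marginals are bounded only from above. Applying the bound to the
      non-out-neighbours of \<open>v\<close> as well bounds the expected number of out-neighbours
      from below, because every set has exactly four elements.\<close>
    have NS': "(\<Sum>i\<in>I. w i * (4 - N v i)) = (\<Sum>u\<in>{u \<in> R'. \<not> E v u}. p u)"
    proof -
      have "w i * (4 - N v i) = w i * real (card {u \<in> S i. \<not> E v u})" if "i \<in> I" for i
      proof (cases "w i = 0")
        case False
        then have "w i > 0" using w0[OF that] by simp
        then have "card (S i) = 4" using S[OF that] by simp
        then have "finite (S i)" by (metis card.infinite zero_neq_numeral)
        then have "card {u \<in> S i. E v u} + card {u \<in> S i. \<not> E v u} = 4"
          using \<open>card (S i) = 4\<close> card_split[of "S i" "E v"] by simp
        then have "4 - N v i = real (card {u \<in> S i. \<not> E v u})" by (simp add: N_def)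
        then show ?thesis by simp
      qed simp
      then have "(\<Sum>i\<in>I. w i * (4 - N v i)) = (\<Sum>i\<in>I. w i * real (card {u \<in> S i. \<not> E v u}))"
        by (rule sum.cong[OF refl])
      also have "\<dots> = (\<Sum>u\<in>{u \<in> R'. \<not> E v u}. p u)"
        unfolding p_def by (rule sum_weight_card_Int[OF finR(2) fin(2) S'])
      finally show ?thesis .
    qed
    have bound: "(\<Sum>u\<in>{u \<in> R'. P u}. p u) \<le> real (card {u \<in> R. P u}) * (4 / r')" for P
    proof -
      have "(\<Sum>u\<in>{u \<in> R'. P u}. p u) \<le> real (card {u \<in> R'. P u}) * (4 / r')"
        using p_le by (intro sum_bounded_above) auto
      also have "\<dots> \<le> real (card {u \<in> R. P u}) * (4 / r')"
        using sub finR r by (intro mult_right_mono) (auto intro!: card_mono)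
      finally show ?thesis .
    qed
    have o: "real (card {u \<in> R. E v u}) = \<phi> v * r" using r by (simp add: \<phi>_def outdeg_def)
    have "card {u \<in> R. E v u} + card {u \<in> R. \<not> E v u} = card R"
      by (rule card_split[OF finR(1)])
    then have o': "real (card {u \<in> R. \<not> E v u}) = (1 - \<phi> v) * r"
      using o by (simp add: r_def algebra_simps flip: of_nat_add)
    have le1: "(\<Sum>i\<in>I. w i * N v i) \<le> 4 * \<phi> v * (r / r')"
      using bound[of "E v"] unfolding NS o by (simp add: mult_ac)
    have le2: "4 * m - (\<Sum>i\<in>I. w i * N v i) \<le> 4 * (1 - \<phi> v) * (r / r')"
    proof -
      have "4 * m - (\<Sum>i\<in>I. w i * N v i) = (\<Sum>i\<in>I. w i * (4 - N v i))"
        by (simp add: right_diff_distrib sum_subtractf sum_distrib_right[symmetric] m_def)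
      also have "\<dots> \<le> (1 - \<phi> v) * r * (4 / r')"
        using bound[of "\<lambda>u. \<not> E v u"] unfolding NS' o' .
      finally show ?thesis by (simp add: mult_ac)
    qed
    have "r / r' \<ge> 1" using r by simp
    then have ge0: "r / r' - m \<ge> 0" using m(2) by (simp add: m_def)
    have "\<phi> v * (r / r' - m) \<le> 1 * \<rho>" "(1 - \<phi> v) * (r / r' - m) \<le> 1 * \<rho>"
      using \<phi>[of v] ge0 \<rho> by (intro mult_mono; simp add: r_def r'_def m_def)+
    moreover define q where "q = r / r'"
    ultimately have "\<bar>4 * \<phi> v * m - (\<Sum>i\<in>I. w i * N v i)\<bar> \<le> 4 * \<rho>"
      using le1 le2 unfolding q_def[symmetric] by (intro abs_leI) (simp_all add: algebra_simps)
    moreover have "(\<Sum>i\<in>I. w i * \<delta> v i) = (4 * \<phi> v * m - (\<Sum>i\<in>I. w i * N v i)) / (r - 4)"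
    proof -
      have "(\<Sum>i\<in>I. w i * \<delta> v i) = (\<Sum>i\<in>I. 4 * \<phi> v * w i - w i * N v i) / (r - 4)"
        unfolding \<delta>_def sum_divide_distrib by (intro sum.cong refl) (simp add: algebra_simps)
      then show ?thesis by (simp only: sum_subtractf sum_distrib_left m_def)
    qed
    ultimately show ?thesis using r by (simp add: abs_divide divide_right_mono)
  qed
  \<comment> \<open>In the expanded square the linear term is controlled by \<open>drift\<close> and
    the quadratic one by the size of a single change.\<close>
  have avg: "(\<Sum>i\<in>I. w i * (\<phi> v + \<delta> v i - \<psi> v)\<^sup>2) \<le> m * (\<phi> v - \<psi> v)\<^sup>2 + e" for v
  proof -
    have "(\<Sum>i\<in>I. w i * (\<delta> v i)\<^sup>2) \<le> (\<Sum>i\<in>I. w i * (16 / (r - 4)\<^sup>2))"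
    proof (rule sum_mono)
      fix i assume i: "i \<in> I"
      show "w i * (\<delta> v i)\<^sup>2 \<le> w i * (16 / (r - 4)\<^sup>2)"
      proof (cases "w i = 0")
        case False
        then have "w i > 0" using w0[OF i] by simp
        then have "\<bar>4 * \<phi> v - N v i\<bar> \<le> 4" using N[OF i, of v] \<phi>[of v] by (simp add: abs_le_iff)
        then have "(4 * \<phi> v - N v i)\<^sup>2 \<le> 4\<^sup>2" using power_mono[of "\<bar>4 * \<phi> v - N v i\<bar>" 4 2] by simp
        then have "(\<delta> v i)\<^sup>2 \<le> 16 / (r - 4)\<^sup>2"
          by (simp add: \<delta>_def power_divide divide_right_mono)
        then show ?thesis using w0[OF i] by (rule mult_left_mono)
      qed simp
    qed
    also have "\<dots> = m * (16 / (r - 4)\<^sup>2)" by (simp only: m_def sum_distrib_right)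
    also have "\<dots> \<le> 1 * (16 / (r - 4)\<^sup>2)" using m(2) by (intro mult_right_mono) (simp_all add: m_def)
    finally have q: "(\<Sum>i\<in>I. w i * (\<delta> v i)\<^sup>2) \<le> 16 / (r - 4)\<^sup>2" by simp
    have "2 * (\<phi> v - \<psi> v) * (\<Sum>i\<in>I. w i * \<delta> v i) \<le> 2 * (\<bar>\<phi> v - \<psi> v\<bar> * \<bar>\<Sum>i\<in>I. w i * \<delta> v i\<bar>)"
      using abs_ge_self[of "(\<phi> v - \<psi> v) * (\<Sum>i\<in>I. w i * \<delta> v i)"]
      unfolding abs_mult mult.assoc by linarith
    also have "\<dots> \<le> 2 * (1 * (4 * \<rho> / (r - 4)))"
      using drift[of v] \<phi>[of v] \<psi>[of v] by (intro mult_left_mono mult_mono) (auto simp: abs_le_iff)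
    finally have l: "2 * (\<phi> v - \<psi> v) * (\<Sum>i\<in>I. w i * \<delta> v i) \<le> 8 * \<rho> / (r - 4)" by simp
    have "(\<Sum>i\<in>I. w i * (\<phi> v + \<delta> v i - \<psi> v)\<^sup>2) = (\<Sum>i\<in>I. w i * (\<phi> v - \<psi> v)\<^sup>2
        + 2 * (\<phi> v - \<psi> v) * (w i * \<delta> v i) + w i * (\<delta> v i)\<^sup>2)"
      by (intro sum.cong refl) (simp add: power2_eq_square algebra_simps)
    also have "\<dots> = m * (\<phi> v - \<psi> v)\<^sup>2 + 2 * (\<phi> v - \<psi> v) * (\<Sum>i\<in>I. w i * \<delta> v i) + (\<Sum>i\<in>I. w i * (\<delta> v i)\<^sup>2)"
      by (simp only: sum.distrib sum_distrib_left sum_distrib_right m_def)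
    finally show ?thesis using q l by (simp add: e_def)
  qed
  have dev: "deviation E V R = (\<Sum>v\<in>V. (\<phi> v - \<psi> v)\<^sup>2)"
    by (simp add: deviation_def \<phi>_def \<psi>_def r_def)
  have "(\<Sum>i\<in>I. w i * deviation E V (R - S i)) = (\<Sum>i\<in>I. \<Sum>v\<in>V. w i * (\<phi> v + \<delta> v i - \<psi> v)\<^sup>2)"
  proof (rule sum.cong[OF refl])
    fix i assume i: "i \<in> I"
    show "w i * deviation E V (R - S i) = (\<Sum>v\<in>V. w i * (\<phi> v + \<delta> v i - \<psi> v)\<^sup>2)"
    proof (cases "w i = 0")
      case False
      then have "w i > 0" using w0[OF i] by simp
      then show ?thesis
        unfolding deviation_def new[OF i \<open>w i > 0\<close>] \<psi>_def[symmetric] sum_distrib_left by simp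
    qed simp
  qed
  also have "\<dots> = (\<Sum>v\<in>V. \<Sum>i\<in>I. w i * (\<phi> v + \<delta> v i - \<psi> v)\<^sup>2)" by (rule sum.swap)
  also have "\<dots> \<le> (\<Sum>v\<in>V. m * (\<phi> v - \<psi> v)\<^sup>2 + e)" by (intro sum_mono avg)
  also have "\<dots> = m * deviation E V R + real (card V) * e"
    by (simp add: dev sum.distrib sum_distrib_left)
  finally obtain i where i: "i \<in> I" "w i > 0" "deviation E V (R - S i) \<le> deviation E V R + real (card V) * e / m"
    using weighted_average_exists[OF fin(2) w0, where f = "\<lambda>i. deviation E V (R - S i)"] m(1)
    by (force simp: m_def)
  have "\<rho> \<ge> 0"
  proof -
    have "r / r' \<ge> 1" using r by simp
    then show ?thesis using \<rho> m(2) by (simp add: r_def r'_def)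
  qed
  then have "real (card V) * e \<ge> 0" using r by (simp add: e_def)
  \<comment> \<open>The total weight is at least 1/2, hence the factor 2 in the conclusion.\<close>
  then have "real (card V) * e / m \<le> real (card V) * e / (1/2)"
    using m(1) by (intro divide_left_mono) (auto simp: m_def)
  also have "\<dots> = 2 * (real (card V) * e)" by simp
  finally have "real (card V) * e / m \<le> 2 * (real (card V) * e)" .
  then have "deviation E V (R - S i) \<le> deviation E V R + 2 * (real (card V) * e)"
    using i(3) by linarith
  then show ?thesis using i(1,2) unfolding e_def r_def by blast
qed

lemma sum_quadruples:
  "(\<Sum>(a, b, c, d)\<in>A \<times> B \<times> C \<times> D. f a b c d) = (\<Sum>a\<in>A. \<Sum>b\<in>B. \<Sum>c\<in>C. \<Sum>d\<in>D. f a b c d)"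
  unfolding sum.cartesian_product ..

lemma sum_mult_of_bool_eq:
  fixes f :: "'a \<Rightarrow> real"
  assumes "finite A" "u \<in> A"
  shows "(\<Sum>a\<in>A. f a * of_bool (u = a)) = f u"
proof -
  have "(\<Sum>a\<in>A. f a * of_bool (u = a)) = (\<Sum>a\<in>A. if u = a then f a else 0)"
    by (intro sum.cong) auto
  then show ?thesis using assms by simp
qed

context finite_tournament begin

lemma subtournament: "R \<subseteq> V \<Longrightarrow> finite_tournament R E"
  by unfold_locales (use finite_V irrefl exactly_one in \<open>blast intro: finite_subset\<close>)+

lemma excess_outdeg:
  assumes "v \<in> V"
  shows "excess v = 2 * outdeg E V v - (real (card V) - 1)"
proof -
  have "k v u = 2 * of_bool (E v u) - 1 + of_bool (v = u)" if "u \<in> V" for u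
    using exactly_one[OF assms that] irrefl[OF assms] by (cases "v = u") (auto simp: k_def)
  then have "excess v = (\<Sum>u\<in>V. 2 * of_bool (E v u) - 1 + of_bool (v = u))"
    unfolding excess_def by (rule sum.cong[OF refl])
  also have "\<dots> = 2 * (\<Sum>u\<in>V. of_bool (E v u)) - real (card V) + (\<Sum>u\<in>V. of_bool (v = u))"
    by (simp only: sum.distrib sum_subtractf sum_distrib_left) simp
  also have "(\<Sum>u\<in>V. of_bool (v = u) :: real) = 1"
    using sum_mult_of_bool_eq[OF finite_V assms, of "\<lambda>_. 1"] by simp
  also have "(\<Sum>u\<in>V. of_bool (E v u)) = outdeg E V v"
    using finite_V by (simp add: outdeg_def of_bool_def sum.If_cases Int_def conj_commute)
  finally show ?thesis by simp
qed

end

lemma D_tuple_card: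
  assumes "finite_tournament V E" "{a, b, c, d} \<subseteq> V" "D_tuple E a b c d"
  shows "card {a, b, c, d} = 4"
proof -
  interpret finite_tournament V E by fact
  have "a \<noteq> b" "b \<noteq> c" "b \<noteq> d" "c \<noteq> a" "d \<noteq> a" "c \<noteq> d"
    using assms irrefl by (auto simp: D_tuple_def)
  then show ?thesis by auto
qed

context near_regular_tournament begin

text \<open>Adding the marginals of the four positions bounds the weight of the copies through a
  vertex by 4 / n.\<close>

lemma balanced_D_distribution:
  obtains w :: "'a \<times> 'a \<times> 'a \<times> 'a \<Rightarrow> real" where
    "\<And>q. w q \<ge> 0"
    and "\<And>a b c d. w (a, b, c, d) > 0 \<Longrightarrow> D_tuple E a b c d"
    and "\<And>u. u \<in> V \<Longrightarrow> (\<Sum>(a, b, c, d)\<in>V \<times> V \<times> V \<times> V. w (a, b, c, d) * of_bool (u \<in> {a, b, c, d})) \<le> 4 / n"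
    and "sum w (V \<times> V \<times> V \<times> V) \<le> 1"
    and "sum w (V \<times> V \<times> V \<times> V) \<ge> 1 - 20 / n"
proof -
  obtain W :: "'a \<Rightarrow> 'a \<Rightarrow> 'a \<Rightarrow> 'a \<Rightarrow> real"
    where W0: "\<And>a b c d. W a b c d \<ge> 0"
    and WD: "\<And>a b c d. W a b c d > 0 \<Longrightarrow> D_tuple E a b c d"
    and W1: "\<And>v. v \<in> V \<Longrightarrow> (\<Sum>b\<in>V. \<Sum>c\<in>V. \<Sum>d\<in>V. W v b c d) \<le> 1 / n"
    and W2: "\<And>v. v \<in> V \<Longrightarrow> (\<Sum>a\<in>V. \<Sum>c\<in>V. \<Sum>d\<in>V. W a v c d) \<le> 1 / n"
    and W3: "\<And>v. v \<in> V \<Longrightarrow> (\<Sum>a\<in>V. \<Sum>b\<in>V. \<Sum>d\<in>V. W a b v d) \<le> 1 / n"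
    and W4: "\<And>v. v \<in> V \<Longrightarrow> (\<Sum>a\<in>V. \<Sum>b\<in>V. \<Sum>c\<in>V. W a b c v) \<le> 1 / n"
    and W5: "(\<Sum>a\<in>V. \<Sum>b\<in>V. \<Sum>c\<in>V. \<Sum>d\<in>V. W a b c d) \<ge> 1 - 20 / n"
    using balanced_D_weights by blast
  define w where "w = (\<lambda>(a, b, c, d). W a b c d)"
  have sum_w: "sum w (V \<times> V \<times> V \<times> V) = (\<Sum>a\<in>V. \<Sum>b\<in>V. \<Sum>c\<in>V. \<Sum>d\<in>V. W a b c d)"
    unfolding w_def by (rule sum_quadruples)
  show ?thesis
  proof
    show "w q \<ge> 0" for q using W0 by (cases q) (simp add: w_def)
    show "D_tuple E a b c d" if "w (a, b, c, d) > 0" for a b c d using that WD by (simp add: w_def)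
    show "sum w (V \<times> V \<times> V \<times> V) \<ge> 1 - 20 / n" unfolding sum_w by (rule W5)
    have "sum w (V \<times> V \<times> V \<times> V) \<le> (\<Sum>a\<in>V. 1 / n)" unfolding sum_w by (intro sum_mono W1)
    also have "\<dots> = 1" using n_ge by (simp add: n_def)
    finally show "sum w (V \<times> V \<times> V \<times> V) \<le> 1" .
    fix u assume u: "u \<in> V"
    note delta = sum_mult_of_bool_eq[OF finite_V u]
    have "(\<Sum>(a, b, c, d)\<in>V \<times> V \<times> V \<times> V. w (a, b, c, d) * of_bool (u \<in> {a, b, c, d}))
      = (\<Sum>a\<in>V. \<Sum>b\<in>V. \<Sum>c\<in>V. \<Sum>d\<in>V. W a b c d * of_bool (u \<in> {a, b, c, d}))"
      unfolding sum_quadruples by (simp add: w_def)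
    also have "\<dots> \<le> (\<Sum>a\<in>V. \<Sum>b\<in>V. \<Sum>c\<in>V. \<Sum>d\<in>V. W a b c d * of_bool (u = a) + W a b c d * of_bool (u = b)
        + W a b c d * of_bool (u = c) + W a b c d * of_bool (u = d))"
      using W0 by (intro sum_mono) (auto simp: of_bool_def)
    also have "\<dots> = (\<Sum>a\<in>V. \<Sum>b\<in>V. \<Sum>c\<in>V. \<Sum>d\<in>V. W a b c d * of_bool (u = a))
      + (\<Sum>a\<in>V. \<Sum>b\<in>V. \<Sum>c\<in>V. \<Sum>d\<in>V. W a b c d * of_bool (u = b))
      + (\<Sum>a\<in>V. \<Sum>b\<in>V. \<Sum>c\<in>V. \<Sum>d\<in>V. W a b c d * of_bool (u = c))
      + (\<Sum>a\<in>V. \<Sum>b\<in>V. \<Sum>c\<in>V. \<Sum>d\<in>V. W a b c d * of_bool (u = d))"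
      by (simp only: sum.distrib)
    also have "\<dots> = (\<Sum>b\<in>V. \<Sum>c\<in>V. \<Sum>d\<in>V. W u b c d) + (\<Sum>a\<in>V. \<Sum>c\<in>V. \<Sum>d\<in>V. W a u c d)
      + (\<Sum>a\<in>V. \<Sum>b\<in>V. \<Sum>d\<in>V. W a b u d) + (\<Sum>a\<in>V. \<Sum>b\<in>V. \<Sum>c\<in>V. W a b c u)"
      by (simp only: sum_distrib_right[symmetric] delta)
    also have "\<dots> \<le> 1 / n + 1 / n + 1 / n + 1 / n"
      by (intro add_mono W1 W2 W3 W4 u)
    finally show "(\<Sum>(a, b, c, d)\<in>V \<times> V \<times> V \<times> V. w (a, b, c, d) * of_bool (u \<in> {a, b, c, d})) \<le> 4 / n"
      by simp
  qed
qed

end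

context finite_tournament begin

text \<open>Vertices whose density has drifted are set aside, the rest \<open>R'\<close> is near
  regular, and a copy is drawn from the balanced weights on \<open>R'\<close>. Adding 1 to the
  deviation makes the growth multiplicative, ready for iteration.\<close>

lemma exists_D_step:
  assumes reg: "\<And>v. v \<in> V \<Longrightarrow> \<bar>outdeg E V v / real (card V) - 1/2\<bar> \<le> 1 / 10 ^ 6"
    and R: "R \<subseteq> V" "real (card R) \<ge> 10 ^ 6"
    and dev: "deviation E V R \<le> real (card R) / 10 ^ 18"
  obtains a b c d where "{a, b, c, d} \<subseteq> R" "D_tuple E a b c d" "card {a, b, c, d} = 4"
    and "deviation E V (R - {a, b, c, d}) + 1
      \<le> (deviation E V R + 1) * (1 + 64 * 10 ^ 12 * real (card V) / (real (card R))\<^sup>2)"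
proof -
  define r where "r = real (card R)"
  define dv where "dv v = outdeg E R v / r - outdeg E V v / real (card V)" for v
  define Bad where "Bad = {v \<in> R. \<bar>dv v\<bar> > 1 / 10 ^ 6}"
  define R' where "R' = R - Bad"
  define r' where "r' = real (card R')"
  have finR: "finite R" using R(1) finite_V by (rule finite_subset)
  have r: "r \<ge> 1000000" using R(2) by (simp add: r_def)
  \<comment> \<open>Chebyshev's inequality: every bad vertex contributes at least 10^-12 to the
    deviation.\<close>
  have Bad: "real (card Bad) \<le> 10 ^ 12 * deviation E V R"
  proof -
    have "real (card Bad) * (1 / 10 ^ 12) \<le> (\<Sum>v\<in>Bad. (dv v)\<^sup>2)"
    proof (rule sum_bounded_below)
      fix v assume "v \<in> Bad"
      then have "1 / 10 ^ 6 \<le> \<bar>dv v\<bar>" by (simp add: Bad_def)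
      from power_mono[OF this, of 2] show "1 / 10 ^ 12 \<le> (dv v)\<^sup>2" by (simp add: power_divide)
    qed
    also have "\<dots> \<le> (\<Sum>v\<in>V. (dv v)\<^sup>2)"
      using R finite_V by (intro sum_mono2) (auto simp: Bad_def)
    also have "\<dots> = deviation E V R" by (simp add: deviation_def dv_def r_def)
    finally show ?thesis by simp
  qed
  have Bad_r: "real (card Bad) \<le> r / 1000000" using Bad dev by (simp add: r_def)
  have "Bad \<subseteq> R" by (auto simp: Bad_def)
  then have r': "r' = r - real (card Bad)"
    using finR by (simp add: r'_def r_def R'_def card_Diff_subset finite_subset of_nat_diff card_mono)
  have R': "R' \<subseteq> R" "R' \<subseteq> V" using R(1) by (auto simp: R'_def)
  interpret T: finite_tournament R' E using R'(2) by (rule subtournament)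
  \<comment> \<open>Twice the density error of 2 / 10^6, plus the loss of the bad vertices and the
    off-by-one in \<open>excess_outdeg\<close>, stays well below 1 / 50000.\<close>
  have T_excess: "\<bar>T.excess v\<bar> \<le> real (card R') / 50000" if v: "v \<in> R'" for v
  proof -
    have "v \<in> V" "\<bar>dv v\<bar> \<le> 1 / 1000000" using v R(1) by (auto simp: R'_def Bad_def)
    then have "\<bar>outdeg E R v / r - 1/2\<bar> \<le> 2 / 1000000"
      using reg[of v] abs_triangle_ineq[of "dv v" "outdeg E V v / real (card V) - 1/2"]
      by (simp add: dv_def)
    then have "outdeg E R v / r \<le> 1/2 + 2 / 1000000" "outdeg E R v / r \<ge> 1/2 - 2 / 1000000"
      unfolding abs_diff_le_iff by simp_all
    then have o: "outdeg E R v \<le> (1/2 + 2 / 1000000) * r" "outdeg E R v \<ge> (1/2 - 2 / 1000000) * r"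
      using r by (simp_all add: pos_divide_le_eq pos_le_divide_eq)
    have o1: "outdeg E R' v \<le> outdeg E R v"
      unfolding outdeg_def using finR R' by (auto intro!: card_mono)
    have "card {u \<in> R. E v u} \<le> card ({u \<in> R'. E v u} \<union> Bad)"
      using finR by (intro card_mono) (auto simp: R'_def Bad_def)
    also have "\<dots> \<le> card {u \<in> R'. E v u} + card Bad" by (rule card_Un_le)
    finally have o2: "outdeg E R v - real (card Bad) \<le> outdeg E R' v" by (simp add: outdeg_def)
    have "T.excess v = 2 * outdeg E R' v - (r' - 1)"
      using T.excess_outdeg[OF v] by (simp add: r'_def)
    then show ?thesis
      using o o1 o2 Bad_r r unfolding r'_def[symmetric] r' by (intro abs_leI) (simp_all add: field_simps)
  qed
  interpret T: near_regular_tournament R' E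
    using T_excess Bad_r r r' by unfold_locales (simp_all add: r'_def)
  have n: "T.n = r'" by (simp add: T.n_def r'_def)
  obtain w :: "'a \<times> 'a \<times> 'a \<times> 'a \<Rightarrow> real" where w0: "\<And>q. w q \<ge> 0"
    and wD: "\<And>a b c d. w (a, b, c, d) > 0 \<Longrightarrow> D_tuple E a b c d"
    and marg: "\<And>u. u \<in> R' \<Longrightarrow> (\<Sum>(a, b, c, d)\<in>R' \<times> R' \<times> R' \<times> R'. w (a, b, c, d) * of_bool (u \<in> {a, b, c, d})) \<le> 4 / r'"
    and w_le: "sum w (R' \<times> R' \<times> R' \<times> R') \<le> 1"
    and w_ge: "sum w (R' \<times> R' \<times> R' \<times> R') \<ge> 1 - 20 / r'"
    using T.balanced_D_distribution[unfolded n] by blast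
  define I where "I = R' \<times> R' \<times> R' \<times> R'"
  define S where "S = (\<lambda>(a, b, c, d). {a, b, c, d :: 'a})"
  \<comment> \<open>Bounds the expected-value error: bad vertices are never hit, and up to 20 / r'
    of the total weight is missing. The factor 2 comes from r' being at least r / 2.\<close>
  define \<rho> where "\<rho> = 2 * (10 ^ 12 * deviation E V R + 20) / r"
  have r'_ge: "r' \<ge> r / 2" "r' \<ge> 100000" using r' Bad_r r by linarith+
  have "\<exists>q\<in>I. w q > 0 \<and> deviation E V (R - S q) \<le> deviation E V R
    + 2 * (real (card V) * (8 * \<rho> / (real (card R) - 4) + 16 / (real (card R) - 4)\<^sup>2))"
  proof (rule exists_small_deviation_step[OF finite_V _ R(1) R'(1) w0])
    show "finite I" using T.finite_V by (simp add: I_def)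
    show "S q \<subseteq> R' \<and> card (S q) = 4" if "q \<in> I" "w q > 0" for q
    proof (cases q)
      case (fields a b c d)
      then have "{a, b, c, d} \<subseteq> R'" "D_tuple E a b c d" using that wD by (auto simp: I_def)
      then show ?thesis using D_tuple_card[OF T.finite_tournament_axioms] by (simp add: fields S_def)
    qed
    show "(\<Sum>q\<in>I. w q * of_bool (u \<in> S q)) \<le> 4 / real (card R')" if "u \<in> R'" for u
    proof -
      have "(\<Sum>q\<in>I. w q * of_bool (u \<in> S q))
        = (\<Sum>(a, b, c, d)\<in>I. w (a, b, c, d) * of_bool (u \<in> {a, b, c, d}))"
        by (intro sum.cong) (auto simp: S_def)
      then show ?thesis using marg[OF that] by (simp add: I_def r'_def)
    qed
    have "20 / r' \<le> 1/2" using r'_ge by (simp add: field_simps)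
    then show "1/2 \<le> sum w I" using w_ge by (simp add: I_def)
    show "sum w I \<le> 1" using w_le by (simp add: I_def)
    show "4 < card R" using r by (simp add: r_def)
    show "0 < card R'" using r'_ge by (simp add: r'_def)
    have "r / r' - sum w I \<le> r / r' - 1 + 20 / r'" using w_ge by (simp add: I_def)
    also have "\<dots> = (r - r' + 20) / r'" using r'_ge by (simp add: field_simps)
    also have "\<dots> = (real (card Bad) + 20) / r'" by (simp add: r')
    also have "\<dots> \<le> (10 ^ 12 * deviation E V R + 20) / (r / 2)"
      using Bad r'_ge r by (intro frac_le) (simp_all add: deviation_nonneg)
    finally show "real (card R) / real (card R') - sum w I \<le> \<rho>" by (simp add: \<rho>_def r_def r'_def mult.commute)
  qed
  then obtain q where q: "q \<in> I" "w q > 0" and le: "deviation E V (R - S q) \<le> deviation E V R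
    + 2 * (real (card V) * (8 * \<rho> / (r - 4) + 16 / (r - 4)\<^sup>2))" by (auto simp: r_def)
  obtain a b c d where abcd: "q = (a, b, c, d)" by (cases q)
  show ?thesis
  proof
    show D: "D_tuple E a b c d" using wD q abcd by simp
    have sub: "{a, b, c, d} \<subseteq> R'" using q abcd by (auto simp: I_def)
    then show "{a, b, c, d} \<subseteq> R" using R' by blast
    show "card {a, b, c, d} = 4" by (rule D_tuple_card[OF T.finite_tournament_axioms sub D])
    define X where "X = deviation E V R"
    have X: "X \<ge> 0" by (simp add: X_def deviation_nonneg)
    have \<rho>0: "\<rho> \<ge> 0" using X r by (simp add: \<rho>_def X_def)
    have "8 * \<rho> / (r - 4) + 16 / (r - 4)\<^sup>2 \<le> 8 * \<rho> / (r / 2) + 16 / (r / 2)\<^sup>2"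
      using r \<rho>0 by (intro add_mono divide_left_mono power_mono) (auto intro!: mult_pos_pos)
    \<comment> \<open>704 = 640 + 64 collects the additive errors; it is absorbed by the 1 in
      \<open>X + 1\<close>.\<close>
    also have "\<dots> = (32 * 10 ^ 12 * X + 704) / r\<^sup>2"
      using r by (simp add: \<rho>_def X_def field_simps power2_eq_square)
    also have "\<dots> \<le> 32 * 10 ^ 12 * (X + 1) / r\<^sup>2"
      using r by (intro divide_right_mono) auto
    finally have "2 * (real (card V) * (8 * \<rho> / (r - 4) + 16 / (r - 4)\<^sup>2))
        \<le> 2 * (real (card V) * (32 * 10 ^ 12 * (X + 1) / r\<^sup>2))"
      by (intro mult_left_mono) auto
    also have "\<dots> = (X + 1) * (64 * 10 ^ 12 * real (card V) / r\<^sup>2)" by (simp add: mult_ac)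
    finally have "deviation E V (R - S q) + 1 \<le> X + 1 + (X + 1) * (64 * 10 ^ 12 * real (card V) / r\<^sup>2)"
      using le by (simp add: X_def)
    then show "deviation E V (R - {a, b, c, d}) + 1
      \<le> (deviation E V R + 1) * (1 + 64 * 10 ^ 12 * real (card V) / (real (card R))\<^sup>2)"
      unfolding X_def r_def by (simp add: abcd S_def distrib_left)
  qed
qed

end

section \<open>The tiling\<close>

definition D_set :: "('a \<Rightarrow> 'a \<Rightarrow> bool) \<Rightarrow> 'a set \<Rightarrow> bool" where
  "D_set E S \<longleftrightarrow> (\<exists>a b c d. S = {a, b, c, d} \<and> D_tuple E a b c d)"

context finite_tournament begin

text \<open>While at least \<epsilon> n vertices remain, a step multiplies deviation + 1 by at most
  1 + K / n. At most n steps are possible, so the deviation stays below exp K, a constant, which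
  \<open>large\<close> keeps within the tolerance of \<open>exists_D_step\<close>.\<close>

lemma almost_perfect_D_packing:
  fixes \<epsilon> :: real
  assumes reg: "\<And>v. v \<in> V \<Longrightarrow> \<bar>outdeg E V v / real (card V) - 1/2\<bar> \<le> 1 / 10 ^ 6"
    and \<epsilon>: "0 < \<epsilon>" and large: "\<epsilon> * real (card V) \<ge> 10 ^ 18 * exp (64 * 10 ^ 12 / \<epsilon>\<^sup>2)"
  shows "\<exists>\<T>. (\<forall>S\<in>\<T>. S \<subseteq> V \<and> D_set E S) \<and> disjoint \<T> \<and> real (card (V - \<Union>\<T>)) \<le> \<epsilon> * card V"
proof (rule ccontr)
  assume no: "\<not> ?thesis"
  define n where "n = real (card V)"
  define K where "K = 64 * 10 ^ 12 / \<epsilon>\<^sup>2"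
  have K: "K \<ge> 0" by (simp add: K_def)
  have \<epsilon>n: "\<epsilon> * n \<ge> 10 ^ 18 * exp K" using large by (simp add: n_def K_def)
  then have "\<epsilon> * n > 0" by (rule less_le_trans[rotated]) simp
  then have n: "n > 0" using \<epsilon> by (simp add: zero_less_mult_iff)
  \<comment> \<open>If every packing left more than \<epsilon> n vertices, the removal could go on
    for any number \<open>i\<close> of steps.\<close>
  have "\<exists>\<T>. (\<forall>S\<in>\<T>. S \<subseteq> V \<and> D_set E S) \<and> disjoint \<T> \<and> card (V - \<Union>\<T>) + 4 * i = card V
    \<and> deviation E V (V - \<Union>\<T>) + 1 \<le> (1 + K / n) ^ i" for i
  proof (induction i)
    case 0
    then show ?case by (intro exI[of _ "{}"]) (simp add: deviation_def disjoint_def)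
  next
    case (Suc i)
    then obtain \<T> where \<T>: "\<And>S. S \<in> \<T> \<Longrightarrow> S \<subseteq> V \<and> D_set E S" "disjoint \<T>"
      and card: "card (V - \<Union>\<T>) + 4 * i = card V"
      and dev: "deviation E V (V - \<Union>\<T>) + 1 \<le> (1 + K / n) ^ i" by blast
    define R where "R = V - \<Union>\<T>"
    define r where "r = real (card R)"
    have r: "r \<ge> \<epsilon> * n" using no \<T> by (auto simp: r_def R_def n_def not_le intro: less_imp_le)
    have "(1 + K / n) ^ i \<le> exp (K / n) ^ i"
      using K n by (intro power_mono exp_ge_add_one_self) auto
    also have "\<dots> = exp (real i * (K / n))" by (simp only: exp_of_nat_mult)
    also have "\<dots> \<le> exp K"
    proof -
      have "real i \<le> n" using card by (simp add: n_def)
      then have "real i * (K / n) \<le> n * (K / n)" using K n by (intro mult_right_mono) auto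
      then show ?thesis using n by simp
    qed
    finally have "deviation E V R \<le> exp K" using dev by (simp add: R_def)
    then have dev': "deviation E V R \<le> real (card R) / 10 ^ 18"
      using r \<epsilon>n by (simp add: r_def)
    have "(10::real) ^ 6 \<le> 10 ^ 18 * 1" by simp
    also have "\<dots> \<le> 10 ^ 18 * exp K" using K by (intro mult_left_mono) simp_all
    also have "\<dots> \<le> real (card R)" using r \<epsilon>n unfolding r_def by (rule order_trans[rotated])
    finally have r6: "real (card R) \<ge> 10 ^ 6" .
    have "R \<subseteq> V" by (auto simp: R_def)
    then obtain a b c d where D: "{a, b, c, d} \<subseteq> R" "D_tuple E a b c d" "card {a, b, c, d} = 4"
      and step: "deviation E V (R - {a, b, c, d}) + 1
        \<le> (deviation E V R + 1) * (1 + 64 * 10 ^ 12 * n / r\<^sup>2)"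
      using exists_D_step[OF reg _ r6 dev'] unfolding n_def r_def by blast
    define S where "S = {a, b, c, d}"
    have S: "V - \<Union>(insert S \<T>) = R - S" by (auto simp: R_def)
    have finR: "finite R" using finite_V by (simp add: R_def)
    show ?case
    proof (intro exI[of _ "insert S \<T>"] conjI ballI)
      show "A \<subseteq> V" "D_set E A" if "A \<in> insert S \<T>" for A
        using that \<T> D \<open>R \<subseteq> V\<close> by (auto simp: S_def D_set_def)
      show "disjoint (insert S \<T>)"
        using \<T>(2) D(1) by (auto simp: disjoint_def S_def[symmetric] R_def)
      have "card (R - S) + 4 = card R"
        using D finR card_mono[OF finR D(1)] by (simp add: S_def card_Diff_subset)
      then show "card (V - \<Union>(insert S \<T>)) + 4 * Suc i = card V"
        using card unfolding S by (simp add: R_def)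
      have "64 * 10 ^ 12 * n / r\<^sup>2 \<le> 64 * 10 ^ 12 * n / (\<epsilon> * n)\<^sup>2"
      proof (intro divide_left_mono power_mono)
        have "r > 0" using r \<open>\<epsilon> * n > 0\<close> by linarith
        then show "0 < r\<^sup>2 * (\<epsilon> * n)\<^sup>2" using \<epsilon> n by simp
      qed (use r \<epsilon> n in auto)
      also have "\<dots> = K / n" using \<epsilon> n by (simp add: K_def field_simps power2_eq_square)
      finally have "(deviation E V R + 1) * (1 + 64 * 10 ^ 12 * n / r\<^sup>2) \<le> (1 + K / n) ^ i * (1 + K / n)"
        using dev n by (intro mult_mono) (auto simp: R_def deviation_nonneg K intro!: add_nonneg_nonneg)
      then have "deviation E V (R - S) + 1 \<le> (1 + K / n) ^ Suc i"
        using step unfolding S_def power_Suc2 by (rule order_trans[rotated])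
      then show "deviation E V (V - \<Union>(insert S \<T>)) + 1 \<le> (1 + K / n) ^ Suc i"
        unfolding S .
    qed
  qed
  \<comment> \<open>\<open>card V\<close> disjoint copies would need four times as many vertices as
    there are.\<close>
  from this[of "card V"] obtain \<T> where "card (V - \<Union>\<T>) + 4 * card V = card V" by blast
  then show False using n by (simp add: n_def)
qed

end

section \<open>Transfer to tournaments given as pair digraphs\<close>

definition D_copy :: "'a \<Rightarrow> 'a \<Rightarrow> 'a \<Rightarrow> 'a \<Rightarrow> 'a pair_pre_digraph" where
  "D_copy a b c d = \<lparr>pverts = {a, b, c, d},
     parcs = {(a, b), (b, c), (b, d), (c, a), (d, a), (c, d)}\<rparr>"

lemma wf_digraph_D112: "wf_digraph (with_proj D112)"
  by unfold_locales (auto simp: D112_def)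

lemma D_copy_iso:
  assumes "card {a, b, c, d} = 4"
  shows "digraph_iso (with_proj D112) (with_proj (D_copy a b c d))"
proof -
  have dist: "a \<noteq> b" "a \<noteq> c" "a \<noteq> d" "b \<noteq> c" "b \<noteq> d" "c \<noteq> d"
    using assms by (auto simp: card_insert_if split: if_splits)
  define f where "f = case_D112_vertex a b c d"
  define h where "h = \<lparr>iso_verts = f, iso_arcs = map_prod f f, iso_head = snd, iso_tail = fst\<rparr>"
  have f: "inj_on f {Da, Db, Dc1, Dc2}" using dist by (auto simp: f_def)
  have "inj_on (map_prod f f) (parcs D112)"
    by (rule inj_on_subset[OF map_prod_inj_on[OF f f]]) (auto simp: D112_def)
  then have "pre_digraph.digraph_isomorphism (with_proj D112) h"
    using f wf_digraph_D112 by (simp add: pre_digraph.digraph_isomorphism_def h_def) (simp add: D112_def)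
  moreover have "with_proj (D_copy a b c d) = app_iso h (with_proj D112)"
    by (simp add: app_iso_def h_def with_proj_def D_copy_def D112_def f_def)
  ultimately show ?thesis unfolding digraph_iso_def by blast
qed

context tournament begin

lemma finite_tournament: "finite_tournament (pverts G) (\<lambda>u v. (u, v) \<in> parcs G)"
proof
  show "finite (pverts G)" by (rule pair_finite_verts)
  show "(u, u) \<notin> parcs G" for u using pair_no_loops[of "(u, u)"] by auto
qed (rule exactly_one_arc)

lemma D_set_copy:
  assumes "S \<subseteq> pverts G" "D_set (\<lambda>u v. (u, v) \<in> parcs G) S"
  shows "\<exists>F. copy_of_in D112 F G \<and> pverts F = S"
proof -
  let ?E = "\<lambda>u v. (u, v) \<in> parcs G"
  obtain a b c d where S: "S = {a, b, c, d}" and D: "D_tuple ?E a b c d"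
    using assms(2) by (auto simp: D_set_def)
  have ft: "finite_tournament (pverts G) ?E"
    by (rule finite_tournament)
  have copy: "copy_of_in D112 (D_copy a b c d) G"
    if sub: "{a, b, c, d} \<subseteq> pverts G" and D: "D_tuple ?E a b c d" and cd: "?E c d" for c d
    unfolding copy_of_in_def
  proof
    have "wf_digraph (with_proj (D_copy a b c d))" by unfold_locales (auto simp: D_copy_def)
    then show "subgraph (with_proj (D_copy a b c d)) (with_proj G)"
      using sub D cd wf_digraph_axioms
      by (auto simp: subgraph_def compatible_def D_copy_def D_tuple_def with_proj_def)
    show "digraph_iso (with_proj D112) (with_proj (D_copy a b c d))"
      by (rule D_copy_iso[OF D_tuple_card[OF ft sub D]])
  qed
  have "?E c d \<or> ?E d c"
    using exactly_one_arc[of c d] assms(1) D by (auto simp: S D_tuple_def)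
  then show ?thesis
  proof
    assume "?E c d"
    then show ?thesis using copy[of c d] assms(1) D S by (auto simp: D_copy_def)
  next
    assume "?E d c"
    moreover have "D_tuple ?E a b d c" using D by (auto simp: D_tuple_def)
    ultimately show ?thesis using copy[of d c] assms(1) S
      by (intro exI[of _ "D_copy a b d c"]) (auto simp: D_copy_def)
  qed
qed

text \<open>An in-neighbour is never an out-neighbour, so the lower bound on in-degrees becomes an
  upper bound on out-degrees.\<close>

lemma degrees:
  assumes v: "v \<in> pverts G"
  shows "min_semidegree G \<le> outdeg (\<lambda>u v. (u, v) \<in> parcs G) (pverts G) v"
    and "outdeg (\<lambda>u v. (u, v) \<in> parcs G) (pverts G) v + min_semidegree G \<le> card (pverts G)"
proof -
  let ?V = "pverts G"
  have "out_arcs (with_proj G) v = Pair v ` {u \<in> ?V. (v, u) \<in> parcs G}"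
    by (auto simp: out_arcs_def dest: in_arcsD2)
  then have out: "out_degree (with_proj G) v = card {u \<in> ?V. (v, u) \<in> parcs G}"
    by (simp add: out_degree_def card_image inj_on_def)
  have "in_arcs (with_proj G) v = (\<lambda>u. (u, v)) ` {u \<in> ?V. (u, v) \<in> parcs G}"
    by (auto simp: in_arcs_def dest: in_arcsD1)
  then have "in_degree (with_proj G) v = card {u \<in> ?V. (u, v) \<in> parcs G}"
    by (simp add: in_degree_def card_image inj_on_def)
  also have "\<dots> \<le> card {u \<in> ?V. (v, u) \<notin> parcs G}"
  proof (rule card_mono)
    show "finite {u \<in> ?V. (v, u) \<notin> parcs G}" using pair_finite_verts by simp
    show "{u \<in> ?V. (u, v) \<in> parcs G} \<subseteq> {u \<in> ?V. (v, u) \<notin> parcs G}"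
    proof safe
      fix u assume "u \<in> ?V" "(u, v) \<in> parcs G" "(v, u) \<in> parcs G"
      then show False using exactly_one_arc[OF _ v, of u] pair_no_loops[of "(u, v)"] by auto
    qed
  qed
  finally have "in_degree (with_proj G) v \<le> card {u \<in> ?V. (v, u) \<notin> parcs G}" .
  moreover have "card {u \<in> ?V. (v, u) \<in> parcs G} + card {u \<in> ?V. (v, u) \<notin> parcs G} = card ?V"
    by (rule card_split[OF pair_finite_verts])
  moreover have "min_semidegree G \<le> in_degree (with_proj G) v" "min_semidegree G \<le> out_degree (with_proj G) v"
    unfolding min_semidegree_def using v pair_finite_verts by (auto intro!: Min_le)
  ultimately show "min_semidegree G \<le> outdeg (\<lambda>u v. (u, v) \<in> parcs G) ?V v"
    "outdeg (\<lambda>u v. (u, v) \<in> parcs G) ?V v + min_semidegree G \<le> card ?V"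
    unfolding outdeg_def out by linarith+
qed

lemma almost_perfect_tiling:
  fixes \<epsilon> :: real
  assumes deg: "real (min_semidegree G) \<ge> (1/2 - 1 / 10 ^ 6) * card (pverts G)"
    and \<epsilon>: "0 < \<epsilon>" and large: "\<epsilon> * card (pverts G) \<ge> 10 ^ 18 * exp (64 * 10 ^ 12 / \<epsilon>\<^sup>2)"
  shows "\<exists>T. is_tiling D112 T G \<and> real (card (pverts G - (\<Union>F\<in>T. pverts F))) \<le> \<epsilon> * card (pverts G)"
proof -
  let ?E = "\<lambda>u v. (u, v) \<in> parcs G"
  interpret T: finite_tournament "pverts G" ?E
    by (rule finite_tournament)
  have reg: "\<bar>outdeg ?E (pverts G) v / real (card (pverts G)) - 1/2\<bar> \<le> 1 / 10 ^ 6" if v: "v \<in> pverts G" for v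
  proof -
    have "card (pverts G) > 0" using v pair_finite_verts card_gt_0_iff by blast
    then have "(1/2 - 1 / 10 ^ 6) \<le> outdeg ?E (pverts G) v / real (card (pverts G))"
      "outdeg ?E (pverts G) v / real (card (pverts G)) \<le> 1/2 + 1 / 10 ^ 6"
      using degrees[OF v] deg by (simp_all add: field_simps)
    then show ?thesis unfolding abs_diff_le_iff by simp
  qed
  obtain \<T> where \<T>: "\<And>S. S \<in> \<T> \<Longrightarrow> S \<subseteq> pverts G \<and> D_set ?E S" "disjoint \<T>"
    and le: "real (card (pverts G - \<Union>\<T>)) \<le> \<epsilon> * card (pverts G)"
    using T.almost_perfect_D_packing[OF reg \<epsilon> large] by blast
  have "\<exists>F. \<forall>S\<in>\<T>. copy_of_in D112 (F S) G \<and> pverts (F S) = S"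
    using D_set_copy \<T>(1) by (intro bchoice) blast
  then obtain F where F: "\<And>S. S \<in> \<T> \<Longrightarrow> copy_of_in D112 (F S) G \<and> pverts (F S) = S" by blast
  show ?thesis
  proof (intro exI conjI)
    show "is_tiling D112 (F ` \<T>) G"
      using F \<T>(2) by (fastforce simp: is_tiling_def pairwise_def disjnt_def)
    show "real (card (pverts G - (\<Union>F\<in>F ` \<T>. pverts F))) \<le> \<epsilon> * card (pverts G)"
      using le F by (simp cong: SUP_cong)
  qed
qed

end

theorem theorem5p5:
  shows "\<exists>c::real. c > 0 \<and>
    (\<forall>\<epsilon>::real. 0 < \<epsilon> \<and> \<epsilon> < 1 \<longrightarrow>
      (\<exists>n\<^sub>0::nat. \<forall>(n::nat) (G::'a pair_pre_digraph).
        n \<ge> n\<^sub>0 \<and> tournament G \<and> card (pverts G) = n \<and>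
        real (min_semidegree G) \<ge> (1/2 - c) * real n \<longrightarrow>
        (\<exists>T. is_tiling D112 T G \<and>
          real (card (pverts G - (\<Union>F\<in>T. pverts F))) \<le> \<epsilon> * real n)))"
\<comment> \<open>The constant is the tolerance for the out-densities in
  \<open>exists_D_step\<close>.\<close>
proof (intro exI[of _ "1 / 10 ^ 6"] conjI allI impI)
  fix \<epsilon> :: real assume \<epsilon>: "0 < \<epsilon> \<and> \<epsilon> < 1"
  define B where "B = 10 ^ 18 * exp (64 * 10 ^ 12 / \<epsilon>\<^sup>2)"
  show "\<exists>n\<^sub>0::nat. \<forall>(n::nat) (G::'a pair_pre_digraph).
    n \<ge> n\<^sub>0 \<and> tournament G \<and> card (pverts G) = n \<and>
    real (min_semidegree G) \<ge> (1/2 - 1 / 10 ^ 6) * real n \<longrightarrow>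
    (\<exists>T. is_tiling D112 T G \<and> real (card (pverts G - (\<Union>F\<in>T. pverts F))) \<le> \<epsilon> * real n)"
  proof (intro exI[of _ "nat \<lceil>B / \<epsilon>\<rceil>"] allI impI)
    fix n and G :: "'a pair_pre_digraph"
    assume A: "n \<ge> nat \<lceil>B / \<epsilon>\<rceil> \<and> tournament G \<and> card (pverts G) = n \<and>
      real (min_semidegree G) \<ge> (1/2 - 1 / 10 ^ 6) * real n"
    then have "B / \<epsilon> \<le> real n" by linarith
    then have "\<epsilon> * real n \<ge> B" using \<epsilon> by (simp add: field_simps)
    then show "\<exists>T. is_tiling D112 T G \<and> real (card (pverts G - (\<Union>F\<in>T. pverts F))) \<le> \<epsilon> * real n"
      using A \<epsilon> tournament.almost_perfect_tiling[of G \<epsilon>] by (auto simp: B_def)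
  qed
qed simp

end
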